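(* Let $\emptyset\neq\mathcal{H}\subset\mathcal{F}(T)$ and $x^*\in X^*$, and consider the following statements: (i) $\mathcal{H}$-duality for $(\mathrm{P})$ holds at $x^*$, i.e. $(f+\delta_E)^*(x^* )=\varphi_{\mathcal{H}}(x^* )$. (ii) $\left(\overline{\operatorname{co}}\,\mathcal{A}_{\mathcal{H}}\right)\cap\left(\{x^*\}\times\mathbb{R}\right)=\overline{\mathcal{A}_{\mathcal{H}}\cap\left(\{x^*\}\times\mathbb{R}\right)}$. Then (i) $\Rightarrow$ (ii). If, moreover, $\{f;\,f_t,t\in T\}\subset\Gamma(X)$, $E\cap\operatorname{dom}f\neq\emptyset$, and $\mathcal{H}$ is covering, then (i) $\Leftrightarrow$ (ii).
   Context: $X$ is a locally convex Hausdorff (real) topological vector space; its topological dual $X^*$ carries the weak*-topology and $X^*\times\mathbb{R}$ the product topology; overlines denote closures in this topology and $\overline{\operatorname{co}}$ the closed convex hull. $T$ is an infinite index set, $f$ and $f_t$ ($t\in T$) are convex proper functions $X\to\mathbb{R}\cup\{+\infty\}$, and $\mathcal{F}(T)$ is the family of all non-empty finite subsets of $T$. The convention $0\times(+\infty)=0$ is used. $\Gamma(X)$ is the class of lower semicontinuous proper convex functions on $X$. $(\mathrm{P})$: $\inf f(x)$ s.t. $f_t(x)\le 0$, $t\in T$; its feasible set is $E:=\{x\in X:f_t(x)\le0\ \forall t\in T\}$, with indicator function $\delta_E$ ($0$ on $E$, $+\infty$ elsewhere). For $h:X\to\overline{\mathbb{R}}$, $h^*(x^* )=\sup_{x\in X}\{\langle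 x^*,x\rangle-h(x)\}$ and $\operatorname{epi}h^*=\{(x^*,r)\in X^*\times\mathbb{R}:h^*(x^* )\le r\}$. $\mathcal{A}_{\mathcal{H}}:=\bigcup_{H\in\mathcal{H}}\bigcup_{\mu\in\mathbb{R}_+^H}\operatorname{epi}\left(f+\sum_{t\in H}\mu_tf_t\right)^*$, and $\varphi_{\mathcal{H}}(x^* ):=\inf_{H\in\mathcal{H}}\inf_{\mu\in\mathbb{R}_+^H}\left(f+\sum_{t\in H}\mu_tf_t\right)^*(x^* )\in\overline{\mathbb{R}}$. $\mathcal{H}$ is covering if $\bigcup_{H\in\mathcal{H}}H=T$. *)

theory Defs
  imports "HOL-Analysis.Analysis"
begin

text \<open>
  The last condition on \<open>V\<close> is \<open>convex V\<close>, unfolded because \<^const>\<open>convex\<close> is not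
  available inside a class specification.
\<close>

class locally_convex_t2_space = real_vector + topological_ab_group_add + t2_space +
  assumes tendsto_scaleR_nhds_prod:
    "filterlim (\<lambda>(c, y). c *\<^sub>R y) (nhds (a *\<^sub>R x)) (nhds a \<times>\<^sub>F nhds x)"
  assumes locally_convex_at_0:
    "open U \<Longrightarrow> 0 \<in> U \<Longrightarrow> \<exists>V. open V \<and> 0 \<in> V \<and> V \<subseteq> U \<and>
      (\<forall>x\<in>V. \<forall>y\<in>V. \<forall>u\<ge>0. \<forall>v\<ge>0. u + v = 1 \<longrightarrow> u *\<^sub>R x + v *\<^sub>R y \<in> V)"

typedef (overloaded) 'a dual =
  "{\<phi> :: 'a::locally_convex_t2_space \<Rightarrow> real. linear \<phi> \<and> continuous_on UNIV \<phi>}"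
  morphisms dual_apply Dual
proof
  show "(\<lambda>_. 0) \<in> {\<phi> :: 'a \<Rightarrow> real. linear \<phi> \<and> continuous_on UNIV \<phi>}"
    by (simp add: linear_iff)
qed

setup_lifting type_definition_dual

instantiation dual :: (locally_convex_t2_space) real_vector
begin

lift_definition zero_dual :: "'a dual" is "\<lambda>_. 0"
  by (simp add: linear_iff)

lift_definition plus_dual :: "'a dual \<Rightarrow> 'a dual \<Rightarrow> 'a dual" is "\<lambda>\<phi> \<psi> x. \<phi> x + \<psi> x"
  by (auto simp: linear_iff algebra_simps intro!: continuous_intros)

lift_definition uminus_dual :: "'a dual \<Rightarrow> 'a dual" is "\<lambda>\<phi> x. - \<phi> x"
  by (auto simp: linear_iff intro!: continuous_intros)

lift_definition minus_dual :: "'a dual \<Rightarrow> 'a dual \<Rightarrow> 'a dual" is "\<lambda>\<phi> \<psi> x. \<phi> x - \<psi> x"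
  by (auto simp: linear_iff algebra_simps intro!: continuous_intros)

lift_definition scaleR_dual :: "real \<Rightarrow> 'a dual \<Rightarrow> 'a dual" is "\<lambda>c \<phi> x. c * \<phi> x"
  by (auto simp: linear_iff algebra_simps intro!: continuous_intros)

instance
  by standard (transfer; simp add: algebra_simps fun_eq_iff)+

end

text \<open>
  The weak* topology: the initial topology for the evaluations, i.e. the one induced by
  the product topology (pointwise convergence) on \<^typ>\<open>'a \<Rightarrow> real\<close>.
\<close>

instantiation dual :: (locally_convex_t2_space) topological_space
begin

definition open_dual :: "'a dual set \<Rightarrow> bool" where
  "open_dual U \<longleftrightarrow> openin (pullback_topology UNIV dual_apply euclidean) U"

instance
proof
  show "open (UNIV :: 'a dual set)"
    unfolding open_dual_def openin_pullback_topology by (metis Int_UNIV_right open_UNIV open_openin vimage_UNIV)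
qed (auto simp: open_dual_def)

end

text \<open>
  Functions into \<open>\<real> \<union> {+\<infinity>}\<close> are \<^typ>\<open>ereal\<close>-valued, the value \<open>-\<infinity>\<close> being excluded by
  properness.  In \<^typ>\<open>ereal\<close> one has \<open>0 * \<infinity> = 0\<close>.
\<close>

definition domain :: "('a \<Rightarrow> ereal) \<Rightarrow> 'a set" where
  "domain h = {x. h x < \<infinity>}"

definition proper :: "('a \<Rightarrow> ereal) \<Rightarrow> bool" where
  "proper h \<longleftrightarrow> (\<forall>x. h x \<noteq> -\<infinity>) \<and> domain h \<noteq> {}"

definition convex_fun :: "('a::real_vector \<Rightarrow> ereal) \<Rightarrow> bool" where
  "convex_fun h \<longleftrightarrow> (\<forall>x y. \<forall>u\<ge>0. \<forall>v\<ge>0. u + v = 1 \<longrightarrow>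
     h (u *\<^sub>R x + v *\<^sub>R y) \<le> ereal u * h x + ereal v * h y)"

definition lsc :: "('a::topological_space \<Rightarrow> ereal) \<Rightarrow> bool" where
  "lsc h \<longleftrightarrow> (\<forall>x. h x \<le> Liminf (nhds x) h)"

definition lsc_proper_convex :: "('a::locally_convex_t2_space \<Rightarrow> ereal) set" where
  "lsc_proper_convex = {h. lsc h \<and> proper h \<and> convex_fun h}"

definition conjugate :: "('a::locally_convex_t2_space \<Rightarrow> ereal) \<Rightarrow> 'a dual \<Rightarrow> ereal" where
  "conjugate h \<xi> = (SUP x. ereal (dual_apply \<xi> x) - h x)"

definition epi :: "('b \<Rightarrow> ereal) \<Rightarrow> ('b \<times> real) set" where
  "epi g = {(y, r). g y \<le> ereal r}"

definition indicator_fun :: "'a set \<Rightarrow> 'a \<Rightarrow> ereal" where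
  "indicator_fun S x = (if x \<in> S then 0 else \<infinity>)"

definition nonempty_finite_subsets :: "'t set \<Rightarrow> 't set set" where
  "nonempty_finite_subsets T = {H. H \<noteq> {} \<and> finite H \<and> H \<subseteq> T}"

definition covering :: "'t set \<Rightarrow> 't set set \<Rightarrow> bool" where
  "covering T \<H> \<longleftrightarrow> \<Union>\<H> = T"

definition feasible :: "'t set \<Rightarrow> ('t \<Rightarrow> 'a \<Rightarrow> ereal) \<Rightarrow> 'a set" where
  "feasible T ft = {x. \<forall>t\<in>T. ft t x \<le> 0}"

definition lagrangian ::
    "('a \<Rightarrow> ereal) \<Rightarrow> ('t \<Rightarrow> 'a \<Rightarrow> ereal) \<Rightarrow> 't set \<Rightarrow> ('t \<Rightarrow> real) \<Rightarrow> 'a \<Rightarrow> ereal" where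
  "lagrangian f ft H \<mu> x = f x + (\<Sum>t\<in>H. ereal (\<mu> t) * ft t x)"

definition multiplier_epis ::
    "('a::locally_convex_t2_space \<Rightarrow> ereal) \<Rightarrow> ('t \<Rightarrow> 'a \<Rightarrow> ereal) \<Rightarrow> 't set set \<Rightarrow> ('a dual \<times> real) set" where
  "multiplier_epis f ft \<H> = (\<Union>H\<in>\<H>. \<Union>\<mu>\<in>H \<rightarrow>\<^sub>E {0..}. epi (conjugate (lagrangian f ft H \<mu>)))"

definition multiplier_dual_value ::
    "('a::locally_convex_t2_space \<Rightarrow> ereal) \<Rightarrow> ('t \<Rightarrow> 'a \<Rightarrow> ereal) \<Rightarrow> 't set set \<Rightarrow> 'a dual \<Rightarrow> ereal" where
  "multiplier_dual_value f ft \<H> \<xi> = (INF H\<in>\<H>. INF \<mu>\<in>H \<rightarrow>\<^sub>E {0..}. conjugate (lagrangian f ft H \<mu>) \<xi>)"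

end

theory Submission
  imports Defs
begin

text \<open>
  Everything happens in the product of the dual with the reals.  Write \<open>A\<close> for the union of the
  epigraphs of the conjugate Lagrangians and \<open>E\<close> for the epigraph of the conjugate of \<open>f\<close> restricted
  to the feasible set.  Both sides of statement (i) can be read off from the fibre over \<open>\<xi>\<close>: the
  fibre of \<open>E\<close> is the half-line starting at the primal value, and the closure of the fibre of \<open>A\<close>
  is the half-line starting at the dual value (\<open>closure_multiplier_epis_fibre\<close>).

  Weak duality says \<open>A \<subseteq> E\<close> (\<open>multiplier_epis_subset\<close>).  As an intersection of half-spaces, \<open>E\<close> is closed
  and convex, so the fibre of the closed convex hull of \<open>A\<close> is squeezed between the closed fibre
  of \<open>A\<close> and the fibre of \<open>E\<close>.  If primal and dual values agree at \<open>\<xi>\<close>, the two outer fibres coincide, which gives (ii).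

  For the converse, the semicontinuity, feasibility and covering hypotheses make the closed convex
  hull of \<open>A\<close> equal to \<open>E\<close>
  (\<open>closure_convex_hull_multiplier_epis\<close>); then (ii) equates the two half-lines, and hence their left
  end points.  A point of \<open>E\<close> outside the hull would be separated from \<open>A\<close> by a weak*-continuous
  functional, which is given by a point \<open>x\<close> of the primal space and a real number
  (\<open>weak_star_separation\<close>).  Read on the primal side, the separation bounds all biconjugate Lagrangians at a
  suitable point \<open>y\<close> built from \<open>x\<close>.  By the Fenchel-Moreau theorem (\<open>Fenchel_Moreau\<close>) these are the Lagrangians
  themselves, and letting single multipliers grow shows that \<open>y\<close> is feasible and that \<open>f y\<close> obeys the same
  bound (\<open>feasible_if_multiplier_epis_bounded\<close>), which contradicts the separation.

  Both separation arguments, in the primal space and in the dual with the weak* topology, are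
  instances of one purely algebraic statement (\<open>separation_from_convex\<close>), which in turn
  rests on the Hahn-Banach theorem in the form that minimal sublinear functionals are linear.
\<close>

section \<open>The Hahn-Banach theorem and algebraic separation\<close>

definition sublinear :: "('v::real_vector \<Rightarrow> real) \<Rightarrow> bool" where
  "sublinear p \<longleftrightarrow> (\<forall>x y. p (x + y) \<le> p x + p y) \<and> (\<forall>c>0. \<forall>x. p (c *\<^sub>R x) = c * p x)"

lemma sublinearI:
  assumes add: "\<And>x y. p (x + y) \<le> p x + p y"
    and scale: "\<And>c x. c > 0 \<Longrightarrow> p (c *\<^sub>R x) \<le> c * p x"
  shows "sublinear p"
proof -
  have "c * p x \<le> p (c *\<^sub>R x)" if "c > 0" for c x
  proof -
    have "p (inverse c *\<^sub>R c *\<^sub>R x) \<le> inverse c * p (c *\<^sub>R x)"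
      using that by (intro scale) simp
    then show ?thesis using that by (simp add: field_simps)
  qed
  then show ?thesis
    unfolding sublinear_def using add scale by (blast intro: antisym)
qed

lemma sublinear_add: "sublinear p \<Longrightarrow> p (x + y) \<le> p x + p y"
  and sublinear_scaleR: "sublinear p \<Longrightarrow> c > 0 \<Longrightarrow> p (c *\<^sub>R x) = c * p x"
  by (auto simp: sublinear_def)

lemma sublinear_zero: "sublinear p \<Longrightarrow> p 0 = 0"
  using sublinear_scaleR[of p 2 0] by simp

lemma sublinear_minus_le: "sublinear p \<Longrightarrow> - p (- x) \<le> p x"
  using sublinear_add[of p x "- x"] by (simp add: sublinear_zero)

lemma sublinear_scaleR_nonneg: "sublinear p \<Longrightarrow> c \<ge> 0 \<Longrightarrow> p (c *\<^sub>R x) = c * p x"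
  by (cases "c = 0") (auto simp: sublinear_zero sublinear_scaleR)

lemma le_cInf_add:
  fixes A B :: "real set"
  assumes "A \<noteq> {}" "B \<noteq> {}" and le: "\<And>a b. a \<in> A \<Longrightarrow> b \<in> B \<Longrightarrow> m \<le> a + b"
  shows "m \<le> Inf A + Inf B"
proof -
  have "m - a \<le> Inf B" if "a \<in> A" for a
    using le[OF that] by (intro cInf_greatest[OF \<open>B \<noteq> {}\<close>]) (simp add: field_simps)
  then have "m - Inf B \<le> a" if "a \<in> A" for a
    using that by (simp add: field_simps)
  then have "m - Inf B \<le> Inf A" by (rule cInf_greatest[OF \<open>A \<noteq> {}\<close>])
  then show ?thesis by simp
qed

text \<open>
  Lowering \<open>q\<close> to the infimum of \<open>q (x + t *\<^sub>R y) - t * q y\<close> over \<open>t \<ge> 0\<close> keeps it sublinear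
  and makes it as small as possible in the direction \<open>- y\<close>.  If \<open>q\<close> is already minimal, this
  changes nothing, and the bound at \<open>t = 1\<close> becomes superadditivity; if \<open>q\<close> is arbitrary, the
  bound at \<open>- y\<close> prescribes the value at \<open>y\<close> of every linear functional below \<open>r\<close>.
\<close>

lemma sublinear_directional_minorant:
  assumes q: "sublinear q"
  obtains r where "sublinear r" "r \<le> q" "\<And>x. r x \<le> q (x + y) - q y" "r (- y) \<le> - q y"
proof -
  define S where "S x = (\<lambda>t. q (x + t *\<^sub>R y) - t * q y) ` {0..}" for x
  define r where "r x = Inf (S x)" for x
  have ne: "S x \<noteq> {}" for x by (auto simp: S_def)
  have bdd: "bdd_below (S x)" for x
  proof (rule bdd_belowI[where m = "- q (- x)"])
    fix s assume "s \<in> S x"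
    then obtain t where t: "t \<ge> 0" "s = q (x + t *\<^sub>R y) - t * q y" by (auto simp: S_def)
    have "t * q y = q ((x + t *\<^sub>R y) + - x)" using sublinear_scaleR_nonneg[OF q t(1)] by simp
    also have "\<dots> \<le> q (x + t *\<^sub>R y) + q (- x)" by (rule sublinear_add[OF q])
    finally show "- q (- x) \<le> s" using t by simp
  qed
  have le: "r x \<le> q (x + t *\<^sub>R y) - t * q y" if "t \<ge> 0" for x t
    unfolding r_def by (rule cInf_lower[OF _ bdd]) (use that in \<open>auto simp: S_def\<close>)
  show ?thesis
  proof
    show "sublinear r"
    proof (rule sublinearI)
      fix x1 x2
      show "r (x1 + x2) \<le> r x1 + r x2"
        unfolding r_def[of x1] r_def[of x2]
      proof (rule le_cInf_add[OF ne ne])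
        fix a b assume "a \<in> S x1" "b \<in> S x2"
        then obtain s t where st: "s \<ge> 0" "t \<ge> 0"
          and ab: "a = q (x1 + s *\<^sub>R y) - s * q y" "b = q (x2 + t *\<^sub>R y) - t * q y"
          by (auto simp: S_def)
        have "r (x1 + x2) \<le> q (x1 + x2 + (s + t) *\<^sub>R y) - (s + t) * q y" using st by (intro le) simp
        also have "x1 + x2 + (s + t) *\<^sub>R y = (x1 + s *\<^sub>R y) + (x2 + t *\<^sub>R y)"
          by (simp add: algebra_simps)
        also have "q ((x1 + s *\<^sub>R y) + (x2 + t *\<^sub>R y)) \<le> q (x1 + s *\<^sub>R y) + q (x2 + t *\<^sub>R y)"
          by (rule sublinear_add[OF q])
        finally show "r (x1 + x2) \<le> a + b" using ab by (simp add: algebra_simps)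
      qed
    next
      fix c :: real and x assume c: "c > 0"
      have "r (c *\<^sub>R x) / c \<le> r x"
        unfolding r_def[of x]
      proof (rule cInf_greatest[OF ne])
        fix a assume "a \<in> S x"
        then obtain t where t: "t \<ge> 0" "a = q (x + t *\<^sub>R y) - t * q y" by (auto simp: S_def)
        have "r (c *\<^sub>R x) \<le> q (c *\<^sub>R x + (c * t) *\<^sub>R y) - (c * t) * q y" using c t by (intro le) simp
        also have "c *\<^sub>R x + (c * t) *\<^sub>R y = c *\<^sub>R (x + t *\<^sub>R y)" by (simp add: algebra_simps)
        also have "q (c *\<^sub>R (x + t *\<^sub>R y)) = c * q (x + t *\<^sub>R y)" by (rule sublinear_scaleR[OF q c])
        finally have "r (c *\<^sub>R x) \<le> c * a" unfolding t(2) by (simp add: algebra_simps)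
        then show "r (c *\<^sub>R x) / c \<le> a" using c by (simp add: field_simps)
      qed
      then show "r (c *\<^sub>R x) \<le> c * r x" using c by (simp add: field_simps)
    qed
    show "r \<le> q" using le[of 0] by (auto simp: le_fun_def)
    show "r x \<le> q (x + y) - q y" for x using le[of 1 x] by simp
    show "r (- y) \<le> - q y" using le[of 1 "- y"] sublinear_zero[OF q] by simp
  qed
qed

text \<open>
  Zorn's lemma applies because every sublinear \<open>q \<le> p\<close> satisfies \<open>- p (- x) \<le> q x\<close>: the pointwise
  infimum of a chain is therefore finite, and it is again sublinear.
\<close>

lemma minimal_sublinear_exists:
  fixes p :: "'v::real_vector \<Rightarrow> real"
  assumes p: "sublinear p"
  obtains m where "sublinear m" "m \<le> p" "\<And>q. sublinear q \<Longrightarrow> q \<le> m \<Longrightarrow> q = m"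
proof -
  define Q where "Q = {q :: 'v \<Rightarrow> real. sublinear q \<and> q \<le> p}"
  have po: "partial_order_on Q (relation_of (\<lambda>a b. b \<le> a) Q)"
    by (rule partial_order_on_relation_ofI) auto
  have "\<exists>m\<in>Q. \<forall>q\<in>Q. q \<le> m \<longrightarrow> q = m"
  proof (rule predicate_Zorn[OF po])
    fix C assume C: "C \<in> Chains (relation_of (\<lambda>a b. b \<le> a) Q)"
    then have CQ: "C \<subseteq> Q" by (rule Chains_relation_of)
    show "\<exists>u\<in>Q. \<forall>a\<in>C. u \<le> a"
    proof (cases "C = {}")
      case True
      then show ?thesis using p by (auto simp: Q_def)
    next
      case False
      define S where "S x = (\<lambda>q. q x) ` C" for x
      define u where "u x = Inf (S x)" for x
      have ne: "S x \<noteq> {}" for x using False by (auto simp: S_def)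
      have bdd: "bdd_below (S x)" for x
      proof (rule bdd_belowI[where m = "- p (- x)"])
        fix s assume "s \<in> S x"
        then obtain q where q: "q \<in> C" "s = q x" by (auto simp: S_def)
        then have "sublinear q" "q (- x) \<le> p (- x)" using CQ by (auto simp: Q_def le_fun_def)
        then show "- p (- x) \<le> s" using sublinear_minus_le[of q x] q by simp
      qed
      have le: "u x \<le> q x" if "q \<in> C" for q x
        unfolding u_def by (rule cInf_lower[OF _ bdd]) (use that in \<open>auto simp: S_def\<close>)
      have "sublinear u"
      proof (rule sublinearI)
        fix x y
        show "u (x + y) \<le> u x + u y"
          unfolding u_def[of x] u_def[of y]
        proof (rule le_cInf_add[OF ne ne])
          fix a b assume "a \<in> S x" "b \<in> S y"
          then obtain q1 q2 where q: "q1 \<in> C" "q2 \<in> C" "a = q1 x" "b = q2 y" by (auto simp: S_def)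
          \<comment> \<open>In a chain the smaller of the two functionals serves both arguments.\<close>
          have "q1 \<le> q2 \<or> q2 \<le> q1"
            using C q(1,2) by (auto simp: Chains_def relation_of_def)
          then obtain q0 where q0: "q0 \<in> C" "q0 \<le> q1" "q0 \<le> q2" using q(1,2) by auto
          have "u (x + y) \<le> q0 (x + y)" by (rule le[OF q0(1)])
          also have "\<dots> \<le> q0 x + q0 y" using q0(1) CQ by (intro sublinear_add) (auto simp: Q_def)
          also have "\<dots> \<le> a + b" using q0 q by (auto simp: le_fun_def intro: add_mono)
          finally show "u (x + y) \<le> a + b" .
        qed
      next
        fix c :: real and x assume c: "c > 0"
        have "u (c *\<^sub>R x) / c \<le> u x"
          unfolding u_def[of x]
        proof (rule cInf_greatest[OF ne])
          fix a assume "a \<in> S x"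
          then obtain q where q: "q \<in> C" "a = q x" by (auto simp: S_def)
          then have "sublinear q" using CQ by (auto simp: Q_def)
          then show "u (c *\<^sub>R x) / c \<le> a"
            using le[OF q(1), of "c *\<^sub>R x"] q c by (simp add: sublinear_scaleR field_simps)
        qed
        then show "u (c *\<^sub>R x) \<le> c * u x" using c by (simp add: field_simps)
      qed
      moreover have "u \<le> p"
      proof -
        obtain q where "q \<in> C" using False by auto
        then have "u \<le> q" "q \<le> p" using le CQ by (auto simp: Q_def le_fun_def)
        then show ?thesis by (rule order_trans)
      qed
      ultimately show ?thesis using le by (auto simp: Q_def le_fun_def)
    qed
  qed
  then obtain m where "m \<in> Q" "\<And>q. q \<in> Q \<Longrightarrow> q \<le> m \<Longrightarrow> q = m" by blast
  then show ?thesis by (intro that[of m]) (auto simp: Q_def)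
qed

lemma minimal_sublinear_linear:
  assumes m: "sublinear m" and min: "\<And>q. sublinear q \<Longrightarrow> q \<le> m \<Longrightarrow> q = m"
  shows "linear m"
proof -
  have super: "m x + m y \<le> m (x + y)" for x y
  proof -
    obtain r where "sublinear r" "r \<le> m" "r x \<le> m (x + y) - m y"
      using sublinear_directional_minorant[OF m, of y] by metis
    then show ?thesis using min by force
  qed
  have add: "m (x + y) = m x + m y" for x y
    using super sublinear_add[OF m] by (intro antisym)
  have neg: "m (- x) = - m x" for x
    using add[of x "- x"] sublinear_zero[OF m] by simp
  have "m (c *\<^sub>R x) = c * m x" for c x
  proof (cases "c \<ge> 0")
    case True
    then show ?thesis by (rule sublinear_scaleR_nonneg[OF m])
  next
    case False
    then show ?thesis
      using sublinear_scaleR_nonneg[OF m, of "- c" x] neg[of "c *\<^sub>R x"] by simp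
  qed
  with add show ?thesis by (simp add: linear_iff)
qed

text \<open>
  A minimal sublinear functional below the directional minorant of \<open>p\<close> at \<open>z\<close> is linear, and
  the minorant forces it to agree with \<open>p\<close> at \<open>z\<close>.
\<close>

theorem Hahn_Banach_sublinear:
  assumes p: "sublinear p"
  obtains \<phi> where "linear \<phi>" "\<And>x. \<phi> x \<le> p x" "\<phi> z = p z"
proof -
  obtain r where r: "sublinear r" "r \<le> p" "r (- z) \<le> - p z"
    using sublinear_directional_minorant[OF p, of z] by metis
  obtain m where m: "sublinear m" "m \<le> r" "\<And>q. sublinear q \<Longrightarrow> q \<le> m \<Longrightarrow> q = m"
    using minimal_sublinear_exists[OF r(1)] by metis
  have "linear m" using minimal_sublinear_linear m by blast
  moreover have le: "m x \<le> p x" for x using m(2) r(2) by (meson le_funD order_trans)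
  moreover have "m z = p z"
  proof (rule antisym[OF le])
    have "- m z = m (- z)" using \<open>linear m\<close> by (simp add: linear_neg)
    also have "\<dots> \<le> - p z" using m(2) r(3) by (meson le_funD order_trans)
    finally show "p z \<le> m z" by simp
  qed
  ultimately show ?thesis by (rule that)
qed

text \<open>
  The Minkowski functional of \<open>W\<close>.
\<close>

definition gauge_fun :: "'v::real_vector set \<Rightarrow> 'v \<Rightarrow> real" where
  "gauge_fun W x = Inf {c. 0 < c \<and> inverse c *\<^sub>R x \<in> W}"

definition absorbing :: "'v::real_vector set \<Rightarrow> bool" where
  "absorbing W \<longleftrightarrow> (\<forall>x. \<exists>c>0. c *\<^sub>R x \<in> W)"

lemma absorbing_zero: "absorbing W \<Longrightarrow> 0 \<in> W"
  unfolding absorbing_def by (metis scaleR_zero_right)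

context
  fixes W :: "'v::real_vector set"
  assumes W: "convex W" "absorbing W"
begin

lemma gauge_scales_nonempty: "{c. 0 < c \<and> inverse c *\<^sub>R x \<in> W} \<noteq> {}"
proof -
  obtain c where "c > 0" "c *\<^sub>R x \<in> W" using W(2) unfolding absorbing_def by blast
  then have "inverse c \<in> {c. 0 < c \<and> inverse c *\<^sub>R x \<in> W}" by simp
  then show ?thesis by blast
qed

lemma gauge_scales_bdd: "bdd_below {c. 0 < c \<and> inverse c *\<^sub>R x \<in> W}"
  by (rule bdd_belowI[where m = 0]) auto

lemma gauge_fun_sublinear: "sublinear (gauge_fun W)"
proof (rule sublinearI)
  fix x y
  show "gauge_fun W (x + y) \<le> gauge_fun W x + gauge_fun W y"
    unfolding gauge_fun_def[of W x] gauge_fun_def[of W y]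
  proof (rule le_cInf_add[OF gauge_scales_nonempty gauge_scales_nonempty], clarsimp)
    fix a b :: real
    assume ab: "0 < a" "inverse a *\<^sub>R x \<in> W" "0 < b" "inverse b *\<^sub>R y \<in> W"
    have "(a / (a + b)) *\<^sub>R (inverse a *\<^sub>R x) + (b / (a + b)) *\<^sub>R (inverse b *\<^sub>R y) \<in> W"
      using ab by (intro convexD[OF W(1)]) (auto simp: add_divide_distrib[symmetric])
    also have "(a / (a + b)) *\<^sub>R (inverse a *\<^sub>R x) + (b / (a + b)) *\<^sub>R (inverse b *\<^sub>R y)
        = inverse (a + b) *\<^sub>R (x + y)"
      using ab by (simp add: scaleR_add_right inverse_eq_divide)
    finally show "gauge_fun W (x + y) \<le> a + b"
      unfolding gauge_fun_def using ab by (intro cInf_lower[OF _ gauge_scales_bdd]) simp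
  qed
next
  fix c :: real and x assume c: "c > 0"
  have "gauge_fun W (c *\<^sub>R x) / c \<le> gauge_fun W x"
    unfolding gauge_fun_def[of W x]
  proof (rule cInf_greatest[OF gauge_scales_nonempty], clarsimp)
    fix a :: real assume a: "0 < a" "inverse a *\<^sub>R x \<in> W"
    have "inverse (c * a) *\<^sub>R (c *\<^sub>R x) = inverse a *\<^sub>R x" using c by (simp add: field_simps)
    then have "gauge_fun W (c *\<^sub>R x) \<le> c * a"
      unfolding gauge_fun_def using a c by (intro cInf_lower[OF _ gauge_scales_bdd]) (simp del: scaleR_scaleR)
    then show "gauge_fun W (c *\<^sub>R x) / c \<le> a" using c by (simp add: field_simps)
  qed
  then show "gauge_fun W (c *\<^sub>R x) \<le> c * gauge_fun W x" using c by (simp add: field_simps)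
qed

lemma gauge_fun_le_one: "x \<in> W \<Longrightarrow> gauge_fun W x \<le> 1"
  unfolding gauge_fun_def by (intro cInf_lower[OF _ gauge_scales_bdd]) simp

lemma gauge_fun_ge_one:
  assumes "x \<notin> W"
  shows "1 \<le> gauge_fun W x"
  unfolding gauge_fun_def
proof (rule cInf_greatest[OF gauge_scales_nonempty], rule ccontr, clarsimp)
  fix c :: real assume c: "0 < c" "inverse c *\<^sub>R x \<in> W" "\<not> 1 \<le> c"
  have "c *\<^sub>R (inverse c *\<^sub>R x) + (1 - c) *\<^sub>R 0 \<in> W"
    using c absorbing_zero[OF W(2)] by (intro convexD[OF W(1)]) auto
  then show False using c assms by simp
qed

end

text \<open>
  With \<open>k0 \<in> K\<close>, the set \<open>W\<close> of all \<open>k - k0 - u\<close> is convex, absorbing and does not contain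
  \<open>z - k0\<close>, so its gauge is at least \<open>1\<close> there and at most \<open>1\<close> on \<open>W\<close>; a linear functional below
  the gauge and touching it at \<open>z - k0\<close> separates.  The lower bound on \<open>U\<close> is what later turns an
  algebraic functional into a continuous one: \<open>U\<close> is a neighbourhood of the origin in whichever
  topology is under consideration.
\<close>

theorem separation_from_convex:
  fixes K U :: "'v::real_vector set"
  assumes K: "convex K" "K \<noteq> {}" and U: "convex U" "absorbing U"
    and disj: "\<forall>u\<in>U. z + u \<notin> K"
  shows "\<exists>(\<phi> :: 'v \<Rightarrow> real) d M. linear \<phi> \<and> d > 0 \<and> (\<forall>k\<in>K. \<phi> k \<le> \<phi> z - d) \<and> (\<forall>u\<in>U. - M \<le> \<phi> u)"
proof -
  obtain k0 where k0: "k0 \<in> K" using K by auto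
  define W where "W = (\<Union>k\<in>K. \<Union>u\<in>U. {k - k0 - u})"
  have "W = (\<lambda>w. w - k0) ` (\<Union>k\<in>K. \<Union>u\<in>U. {k - u})"
    by (auto simp: W_def image_iff algebra_simps) (metis add.commute)+
  then have "convex W" using convex_differences[OF K(1) U(1)]
    by (metis convex_translation_subtract_eq)
  have "absorbing W"
    unfolding absorbing_def
  proof
    fix x
    obtain c where "c > 0" "c *\<^sub>R (- x) \<in> U" using U(2) unfolding absorbing_def by blast
    moreover have "k0 - k0 - c *\<^sub>R (- x) \<in> W" using \<open>c *\<^sub>R (- x) \<in> U\<close> k0 unfolding W_def by blast
    ultimately show "\<exists>c>0. c *\<^sub>R x \<in> W" by (auto intro!: exI[of _ c])
  qed
  have "z - k0 \<notin> W"
  proof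
    assume "z - k0 \<in> W"
    then obtain k u where ku: "k \<in> K" "u \<in> U" "z - k0 = k - k0 - u" by (auto simp: W_def)
    have "z + u = k" using ku(3) by (simp add: algebra_simps)
    then show False using disj ku by blast
  qed
  obtain \<phi> where \<phi>: "linear \<phi>" "\<And>x. \<phi> x \<le> gauge_fun W x" "\<phi> (z - k0) = gauge_fun W (z - k0)"
    using Hahn_Banach_sublinear[OF gauge_fun_sublinear[OF \<open>convex W\<close> \<open>absorbing W\<close>]] by metis
  have z1: "1 \<le> \<phi> (z - k0)"
    using gauge_fun_ge_one[OF \<open>convex W\<close> \<open>absorbing W\<close> \<open>z - k0 \<notin> W\<close>] \<phi>(3) by simp
  have W1: "\<phi> w \<le> 1" if "w \<in> W" for w
    using gauge_fun_le_one[OF \<open>convex W\<close> \<open>absorbing W\<close> that] \<phi>(2)[of w] by simp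
  have key: "\<phi> k - \<phi> u \<le> \<phi> z" if "k \<in> K" "u \<in> U" for k u
  proof -
    have "\<phi> (k - k0 - u) \<le> 1" using that by (intro W1) (auto simp: W_def)
    then show ?thesis using z1 \<phi>(1) by (simp add: linear_diff)
  qed
  \<comment> \<open>The gap comes from a direction on which the functional is negative, scaled into the
    absorbing set.\<close>
  obtain c where c: "c > 0" "c *\<^sub>R (k0 - z) \<in> U" using U(2) unfolding absorbing_def by blast
  define d where "d = - \<phi> (c *\<^sub>R (k0 - z))"
  have "d > 0"
  proof -
    have "d = c * \<phi> (z - k0)" using \<phi>(1) by (simp add: d_def linear_diff linear_scale algebra_simps)
    then show ?thesis using c z1 by simp
  qed
  have "\<phi> k \<le> \<phi> z - d" if "k \<in> K" for k using key[OF that c(2)] by (simp add: d_def)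
  moreover have "- (\<phi> z - \<phi> k0) \<le> \<phi> u" if "u \<in> U" for u using key[OF k0 that] by simp
  ultimately show ?thesis using \<phi>(1) \<open>d > 0\<close> by blast
qed

section \<open>Continuous linear functionals on a locally convex space\<close>

lemma continuous_on_scaleR_lcs:
  "continuous_on UNIV (\<lambda>x :: 'a::locally_convex_t2_space. c *\<^sub>R x)"
  "continuous_on UNIV (\<lambda>c. c *\<^sub>R (x :: 'a::locally_convex_t2_space))"
proof -
  have "((\<lambda>x. c *\<^sub>R x) \<longlongrightarrow> c *\<^sub>R y) (nhds y)" for y :: 'a
    using filterlim_compose[OF tendsto_scaleR_nhds_prod[of c y] filterlim_Pair[OF tendsto_const filterlim_ident]]
    by simp
  then show "continuous_on UNIV (\<lambda>x :: 'a. c *\<^sub>R x)"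
    unfolding continuous_on_def by (blast intro: tendsto_mono[OF at_within_le_nhds])
  have "((\<lambda>c. c *\<^sub>R x) \<longlongrightarrow> c *\<^sub>R x) (nhds c)" for c :: real
    using filterlim_compose[OF tendsto_scaleR_nhds_prod[of c x] filterlim_Pair[OF filterlim_ident tendsto_const]]
    by simp
  then show "continuous_on UNIV (\<lambda>c. c *\<^sub>R x)"
    unfolding continuous_on_def by (blast intro: tendsto_mono[OF at_within_le_nhds])
qed

lemma open_neighbourhood_absorbing:
  fixes V :: "'a::locally_convex_t2_space set"
  assumes "open V" "0 \<in> V"
  shows "absorbing V"
  unfolding absorbing_def
proof
  fix x
  have "open ((\<lambda>c. c *\<^sub>R x) -` V)"
    using continuous_on_scaleR_lcs(2) assms(1) by (rule open_vimage[rotated])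
  then obtain e where "e > 0" "ball 0 e \<subseteq> (\<lambda>c. c *\<^sub>R x) -` V"
    using assms(2) open_contains_ball[of "(\<lambda>c. c *\<^sub>R x) -` V"] by force
  then show "\<exists>c>0. c *\<^sub>R x \<in> V"
    by (intro exI[of _ "e / 2"]) (auto simp: subset_iff dist_real_def)
qed

text \<open>
  On a small multiple of \<open>V\<close> intersected with its reflection, the one-sided bound becomes a
  two-sided bound as small as desired.
\<close>

lemma linear_continuous_if_bounded_below:
  fixes \<phi> :: "'a::locally_convex_t2_space \<Rightarrow> real"
  assumes \<phi>: "linear \<phi>" and V: "open V" "0 \<in> V" and bound: "\<And>v. v \<in> V \<Longrightarrow> - M \<le> \<phi> v"
  shows "continuous_on UNIV \<phi>"
  unfolding continuous_on_def
proof (intro ballI tendstoI)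
  fix x :: 'a and e :: real assume "e > 0"
  define c where "c = (\<bar>M\<bar> + 1) / e"
  have "c > 0" using \<open>e > 0\<close> by (simp add: c_def add_nonneg_pos)
  define S where "S = (\<lambda>y. c *\<^sub>R (y - x)) -` V \<inter> (\<lambda>y. - (c *\<^sub>R (y - x))) -` V"
  have cont: "continuous_on UNIV (\<lambda>y. c *\<^sub>R (y - x))"
    by (intro continuous_on_compose2[OF continuous_on_scaleR_lcs(1)] continuous_intros) auto
  have "open S"
    unfolding S_def using cont V(1)
    by (intro open_Int open_vimage continuous_on_minus) auto
  moreover have "x \<in> S" using V by (simp add: S_def)
  moreover have "dist (\<phi> y) (\<phi> x) < e" if "y \<in> S" for y
  proof -
    have "- M \<le> \<phi> (c *\<^sub>R (y - x))" "- M \<le> \<phi> (- (c *\<^sub>R (y - x)))"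
      using that by (auto simp: S_def intro: bound)
    then have "\<bar>c * (\<phi> y - \<phi> x)\<bar> \<le> \<bar>M\<bar>"
      using \<phi> by (simp add: linear_neg linear_diff linear_scale)
    then have "c * \<bar>\<phi> y - \<phi> x\<bar> < c * e"
      using \<open>c > 0\<close> \<open>e > 0\<close> by (simp add: abs_mult c_def)
    then show ?thesis using \<open>c > 0\<close> by (simp add: dist_real_def)
  qed
  ultimately show "\<forall>\<^sub>F y in at x within UNIV. dist (\<phi> y) (\<phi> x) < e"
    by (auto simp: eventually_at_topological)
qed

lemma dual_apply_linear: "linear (dual_apply \<xi>)"
  using dual_apply[of \<xi>] by simp

lemma dual_apply_add_right: "dual_apply \<xi> (x + y) = dual_apply \<xi> x + dual_apply \<xi> y"
  and dual_apply_scaleR_right: "dual_apply \<xi> (c *\<^sub>R x) = c * dual_apply \<xi> x"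
  using linear_add[OF dual_apply_linear] linear_scale[OF dual_apply_linear] by auto

lemma dual_apply_add: "dual_apply (\<xi> + \<eta>) x = dual_apply \<xi> x + dual_apply \<eta> x"
  and dual_apply_scaleR: "dual_apply (c *\<^sub>R \<xi>) x = c * dual_apply \<xi> x"
  by (transfer; simp)+

lemma linear_fst_snd:
  fixes \<phi> :: "'v::real_vector \<times> real \<Rightarrow> real"
  assumes "linear \<phi>"
  shows "\<phi> (x, t) = \<phi> (x, 0) + \<phi> (0, 1) * t" "linear (\<lambda>x. \<phi> (x, 0))"
proof -
  have "(x, t) = (x, 0) + t *\<^sub>R (0, 1)" by simp
  then have "\<phi> (x, t) = \<phi> (x, 0) + \<phi> (t *\<^sub>R (0, 1))" using linear_add[OF assms] by metis
  also have "\<phi> (t *\<^sub>R (0, 1)) = t *\<^sub>R \<phi> (0, 1)" by (rule linear_scale[OF assms])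
  finally show "\<phi> (x, t) = \<phi> (x, 0) + \<phi> (0, 1) * t" by simp
  show "linear (\<lambda>x. \<phi> (x, 0))"
    using linear_compose[OF _ assms, of "\<lambda>x. (x, 0)"] by (simp add: linear_iff o_def)
qed

section \<open>Conjugates and biconjugation\<close>

text \<open>
  The pair \<open>(\<xi>, r)\<close> lies in the epigraph of the conjugate iff \<open>dual_apply \<xi> x - r\<close> is an affine
  minorant of \<open>h\<close>.  Quantifying over the epigraph of \<open>h\<close> instead of its values keeps
  the whole argument within real arithmetic, whether \<open>h\<close> is finite or infinite at a point.
\<close>

lemma mem_epi_conjugate_iff:
  "(\<xi>, r) \<in> epi (conjugate h) \<longleftrightarrow> (\<forall>x t. (x, t) \<in> epi h \<longrightarrow> dual_apply \<xi> x - t \<le> r)"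
proof -
  have "ereal a - b \<le> ereal r \<longleftrightarrow> (\<forall>t. b \<le> ereal t \<longrightarrow> a - t \<le> r)" for a b
  proof (cases b)
    case (real b')
    have "(\<forall>t. b' \<le> t \<longrightarrow> a - t \<le> r) \<longleftrightarrow> a - b' \<le> r"
      by (auto intro: order_trans[OF diff_left_mono])
    then show ?thesis using real by simp
  next
    case MInf
    have "\<not> (\<forall>t. a - t \<le> r)" by (auto intro!: exI[of _ "a - r - 1"])
    then show ?thesis using MInf by simp
  qed simp
  then show ?thesis by (auto simp: epi_def conjugate_def SUP_le_iff)
qed

lemma convex_epi_convex_fun:
  assumes "convex_fun h"
  shows "convex (epi h)"
proof (rule convexI)
  fix p q and u v :: real
  assume pq: "p \<in> epi h" "q \<in> epi h" and uv: "0 \<le> u" "0 \<le> v" "u + v = 1"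
  obtain x s y t where p: "p = (x, s)" and q: "q = (y, t)" by (cases p, cases q)
  have "h (u *\<^sub>R x + v *\<^sub>R y) \<le> ereal u * h x + ereal v * h y"
    using assms uv by (auto simp: convex_fun_def)
  also have "\<dots> \<le> ereal u * ereal s + ereal v * ereal t"
    using pq uv p q by (intro add_mono ereal_mult_left_mono) (auto simp: epi_def)
  finally show "u *\<^sub>R p + v *\<^sub>R q \<in> epi h" by (simp add: p q epi_def)
qed

lemma lsc_iff_open_superlevel: "lsc h \<longleftrightarrow> (\<forall>a. open {x. a < h x})"
proof -
  have "lsc h \<longleftrightarrow> (\<forall>a x. a < h x \<longrightarrow> (\<forall>\<^sub>F y in nhds x. a < h y))"
    unfolding lsc_def le_Liminf_iff by blast
  also have "\<dots> \<longleftrightarrow> (\<forall>a. open {x. a < h x})"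
  proof -
    have "open {x. a < h x} \<longleftrightarrow> (\<forall>x. a < h x \<longrightarrow> (\<forall>\<^sub>F y in nhds x. a < h y))" for a
      by (subst open_subopen) (simp add: eventually_nhds subset_iff Ball_def)
    then show ?thesis by simp
  qed
  finally show ?thesis .
qed

lemma locally_convex_nbhd:
  fixes x :: "'a::locally_convex_t2_space"
  assumes "open S" "x \<in> S"
  obtains V where "open V" "0 \<in> V" "convex V" "\<And>v. v \<in> V \<Longrightarrow> x + v \<in> S"
proof -
  have "open ((\<lambda>v. x + v) -` S)"
    by (intro open_vimage assms continuous_intros)
  then obtain V where V: "open V" "0 \<in> V" "V \<subseteq> (\<lambda>v. x + v) -` S"
    "\<forall>x\<in>V. \<forall>y\<in>V. \<forall>u\<ge>0. \<forall>v\<ge>0. u + v = 1 \<longrightarrow> u *\<^sub>R x + v *\<^sub>R y \<in> V"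
    using locally_convex_at_0 assms(2) by (metis add.right_neutral vimageI)
  have "convex V" unfolding convex_def by (rule V(4))
  with V show ?thesis by (intro that[of V]) auto
qed

text \<open>
  Lower semicontinuity gives a neighbourhood of \<open>(x, a)\<close> that misses the epigraph, which is all
  that separation needs.  The coefficient \<open>s\<close> cannot be positive since the epigraph
  is unbounded upwards; \<open>s = 0\<close> means that the separating hyperplane is vertical.
\<close>

lemma epigraph_separation:
  fixes h :: "'a::locally_convex_t2_space \<Rightarrow> ereal"
  assumes h: "h \<in> lsc_proper_convex" and x: "ereal a < h x"
  shows "\<exists>\<eta> s d. s \<le> 0 \<and> d > 0 \<and>
    (\<forall>y t. (y, t) \<in> epi h \<longrightarrow> dual_apply \<eta> y + s * t \<le> dual_apply \<eta> x + s * a - d)"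
proof -
  obtain b where b: "a < b" "ereal b < h x" using x ereal_dense2 less_ereal.simps(1) by metis
  have "open {y. ereal b < h y}"
    using h by (simp add: lsc_proper_convex_def lsc_iff_open_superlevel)
  then obtain V where V: "open V" "0 \<in> V" "convex V" "\<And>v. v \<in> V \<Longrightarrow> ereal b < h (x + v)"
    using locally_convex_nbhd[of "{y. ereal b < h y}" x] b(2) by auto
  define U where "U = V \<times> {-(b - a)<..<b - a}"
  have cU: "convex U" unfolding U_def by (intro convex_Times V convex_real_interval)
  have aU: "absorbing U"
    unfolding absorbing_def
  proof
    fix p :: "'a \<times> real"
    obtain y t where p: "p = (y, t)" by (cases p)
    obtain c where c: "c > 0" "c *\<^sub>R y \<in> V"
      using open_neighbourhood_absorbing[OF V(1,2)] unfolding absorbing_def by blast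
    define c' where "c' = min c ((b - a) / (2 * (\<bar>t\<bar> + 1)))"
    have c': "c' > 0" "c' \<le> c" using c b by (auto simp: c'_def)
    have "(c' / c) *\<^sub>R (c *\<^sub>R y) + (1 - c' / c) *\<^sub>R 0 \<in> V"
      using c c' V(2) by (intro convexD[OF V(3)]) auto
    then have "c' *\<^sub>R y \<in> V" using c by simp
    moreover have "\<bar>c' * t\<bar> < b - a"
    proof -
      have "\<bar>c' * t\<bar> = c' * \<bar>t\<bar>" using c' by (simp add: abs_mult)
      also have "\<dots> \<le> (b - a) / (2 * (\<bar>t\<bar> + 1)) * \<bar>t\<bar>"
        by (rule mult_right_mono) (simp_all add: c'_def)
      also have "\<dots> < b - a" using b mult_right_mono[of a b "\<bar>t\<bar>"] by (simp add: field_simps)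
      finally show ?thesis .
    qed
    ultimately have "c' *\<^sub>R p \<in> U" by (auto simp: U_def p)
    then show "\<exists>c>0. c *\<^sub>R p \<in> U" using c' by blast
  qed
  have disj: "\<forall>u\<in>U. (x, a) + u \<notin> epi h"
  proof
    fix u assume "u \<in> U"
    obtain v r where u: "u = (v, r)" "v \<in> V" "r < b - a"
      using \<open>u \<in> U\<close> unfolding U_def by (cases u) auto
    then have "ereal (a + r) < ereal b" by simp
    also have "\<dots> < h (x + v)" by (rule V(4)[OF u(2)])
    finally have "ereal (a + r) < h (x + v)" .
    then show "(x, a) + u \<notin> epi h" by (simp add: epi_def u)
  qed
  obtain y0 where "h y0 < \<infinity>" "h y0 \<noteq> -\<infinity>"
    using h by (auto simp: lsc_proper_convex_def proper_def domain_def)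
  then obtain t0 where t0: "h y0 = ereal t0" by (cases "h y0") auto
  have mem0: "(y0, t0 + r) \<in> epi h" if "r \<ge> 0" for r using that t0 by (simp add: epi_def)
  then have ne: "epi h \<noteq> {}" by blast
  have cK: "convex (epi h)" using h by (intro convex_epi_convex_fun) (auto simp: lsc_proper_convex_def)
  obtain \<phi> :: "'a \<times> real \<Rightarrow> real" and d M where \<phi>: "linear \<phi>" "d > 0" "\<forall>k\<in>epi h. \<phi> k \<le> \<phi> (x, a) - d"
    "\<forall>u\<in>U. - M \<le> \<phi> u"
    using separation_from_convex[OF cK ne cU aU disj] by blast
  have cont: "continuous_on UNIV (\<lambda>y. \<phi> (y, 0))"
    using b by (intro linear_continuous_if_bounded_below[where M = M, OF linear_fst_snd(2)[OF \<phi>(1)] V(1,2)])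
      (use \<phi>(4) in \<open>auto simp: U_def\<close>)
  define \<eta> where "\<eta> = Dual (\<lambda>y. \<phi> (y, 0))"
  have \<eta>: "dual_apply \<eta> y = \<phi> (y, 0)" for y
    unfolding \<eta>_def using linear_fst_snd(2)[OF \<phi>(1)] cont by (subst Dual_inverse) auto
  define s where "s = \<phi> (0, 1)"
  have split: "\<phi> (y, t) = dual_apply \<eta> y + s * t" for y t
    using linear_fst_snd(1)[OF \<phi>(1), of y t] by (simp add: \<eta> s_def)
  have le: "dual_apply \<eta> y + s * t \<le> dual_apply \<eta> x + s * a - d" if "(y, t) \<in> epi h" for y t
    using \<phi>(3) that by (fastforce simp: split)
  have "s \<le> 0"
  proof (rule ccontr)
    assume "\<not> s \<le> 0"
    define C where "C = dual_apply \<eta> x + s * a - d - dual_apply \<eta> y0 - s * t0"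
    have "s * r \<le> C" if "r \<ge> 0" for r
      using le[OF mem0[OF that]] by (simp add: C_def algebra_simps)
    from this[of "(\<bar>C\<bar> + 1) / s"] show False using \<open>\<not> s \<le> 0\<close> by simp
  qed
  then show ?thesis using \<open>d > 0\<close> le by blast
qed

text \<open>
  Divided by \<open>- s\<close>, a non-vertical separating hyperplane is the graph of an affine minorant
  of \<open>h\<close> whose value at \<open>x\<close> exceeds \<open>a\<close>.
\<close>

lemma nonvertical_separation_conjugate:
  assumes "s < 0" and le: "\<And>y t. (y, t) \<in> epi h \<Longrightarrow> dual_apply \<eta> y + s * t \<le> dual_apply \<eta> x + s * a - d"
  shows "((- inverse s) *\<^sub>R \<eta>, dual_apply ((- inverse s) *\<^sub>R \<eta>) x - a + inverse s * d) \<in> epi (conjugate h)"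
  unfolding mem_epi_conjugate_iff
proof (intro allI impI)
  fix y t assume "(y, t) \<in> epi h"
  then have "(- inverse s) * (dual_apply \<eta> y + s * t) \<le> (- inverse s) * (dual_apply \<eta> x + s * a - d)"
    using \<open>s < 0\<close> by (intro mult_left_mono le) auto
  moreover have "inverse s * (s * r) = r" for r using \<open>s < 0\<close> by simp
  ultimately show "dual_apply ((- inverse s) *\<^sub>R \<eta>) y - t
      \<le> dual_apply ((- inverse s) *\<^sub>R \<eta>) x - a + inverse s * d"
    unfolding dual_apply_scaleR by (simp add: distrib_left right_diff_distrib)
qed

text \<open>
  A vertical hyperplane cannot separate the epigraph from a point below a point of the domain,
  so \<open>h\<close> has an affine minorant.
\<close>

lemma epi_conjugate_nonempty:
  assumes h: "h \<in> lsc_proper_convex"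
  shows "epi (conjugate h) \<noteq> {}"
proof -
  obtain y0 where "h y0 < \<infinity>" "h y0 \<noteq> -\<infinity>"
    using h by (auto simp: lsc_proper_convex_def proper_def domain_def)
  then obtain t0 where t0: "h y0 = ereal t0" by (cases "h y0") auto
  have lt: "ereal (t0 - 1) < h y0" by (simp add: t0)
  obtain \<eta> s d where sep: "s \<le> 0" "d > 0"
    "\<forall>y t. (y, t) \<in> epi h \<longrightarrow> dual_apply \<eta> y + s * t \<le> dual_apply \<eta> y0 + s * (t0 - 1) - d"
    using epigraph_separation[OF h lt] by blast
  have "s \<noteq> 0" using sep(2) sep(3)[rule_format, of y0 t0] t0 by (auto simp: epi_def)
  then show ?thesis using nonvertical_separation_conjugate[OF _ sep(3)[rule_format]] sep(1) by (auto simp: less_le)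
qed

text \<open>
  This is the Fenchel-Moreau theorem, with the biconjugate replaced by an arbitrary upper bound \<open>a\<close> of
  the values at \<open>x\<close> of all affine minorants.  If \<open>a < h x\<close>, a non-vertical separating hyperplane is an affine
  minorant above \<open>a\<close> at \<open>x\<close>.  A vertical one can be added to any
  affine minorant with an arbitrarily large factor \<open>l\<close>, which raises its value at \<open>x\<close> by \<open>l * d\<close>.
\<close>

theorem Fenchel_Moreau:
  assumes h: "h \<in> lsc_proper_convex"
    and bound: "\<And>\<xi> r. (\<xi>, r) \<in> epi (conjugate h) \<Longrightarrow> dual_apply \<xi> x - r \<le> a"
  shows "h x \<le> ereal a"
proof (rule ccontr)
  assume "\<not> h x \<le> ereal a"
  then have lt: "ereal a < h x" by simp
  obtain \<eta> s d where sep: "s \<le> 0" "d > 0"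
    "\<forall>y t. (y, t) \<in> epi h \<longrightarrow> dual_apply \<eta> y + s * t \<le> dual_apply \<eta> x + s * a - d"
    using epigraph_separation[OF h lt] by blast
  show False
  proof (cases "s = 0")
    case False
    then have "s < 0" using sep(1) by simp
    have "0 \<le> inverse s * d"
      using bound[OF nonvertical_separation_conjugate[OF \<open>s < 0\<close> sep(3)[rule_format]]] by simp
    then show False using \<open>s < 0\<close> sep(2) by (simp add: zero_le_mult_iff)
  next
    case True
    obtain \<xi> r where \<xi>: "(\<xi>, r) \<in> epi (conjugate h)" using epi_conjugate_nonempty[OF h] by auto
    have "dual_apply \<xi> x - r + l * d \<le> a" if "l \<ge> 0" for l
    proof -
      have "(\<xi> + l *\<^sub>R \<eta>, r + l * (dual_apply \<eta> x - d)) \<in> epi (conjugate h)"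
        unfolding mem_epi_conjugate_iff
      proof (intro allI impI)
        fix y t assume yt: "(y, t) \<in> epi h"
        have "dual_apply \<xi> y - t \<le> r" using \<xi> yt unfolding mem_epi_conjugate_iff by blast
        moreover have "l * dual_apply \<eta> y \<le> l * (dual_apply \<eta> x - d)"
          using sep(3)[rule_format, OF yt] True that by (intro mult_left_mono) auto
        ultimately show "dual_apply (\<xi> + l *\<^sub>R \<eta>) y - t \<le> r + l * (dual_apply \<eta> x - d)"
          by (simp add: dual_apply_add dual_apply_scaleR)
      qed
      from bound[OF this] show ?thesis by (simp add: dual_apply_add dual_apply_scaleR algebra_simps)
    qed
    from this[of "(\<bar>a - dual_apply \<xi> x + r\<bar> + 1) / d"] show False using sep(2) by simp
  qed
qed

section \<open>The weak* topology on the dual\<close>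

lemma continuous_on_dual_apply: "continuous_on UNIV (\<lambda>\<xi>. dual_apply \<xi> x)"
proof (subst continuous_on_open_vimage[OF open_UNIV], intro allI impI)
  fix B :: "real set" assume "open B"
  then have "open ((\<lambda>\<phi> :: 'a \<Rightarrow> real. \<phi> x) -` B)"
    using continuous_on_product_coordinates by (rule open_vimage)
  then show "open ((\<lambda>\<xi>. dual_apply \<xi> x) -` B \<inter> UNIV)"
    unfolding open_dual_def openin_pullback_topology
    by (intro exI[of _ "(\<lambda>\<phi>. \<phi> x) -` B"]) (auto simp: open_openin[symmetric])
qed

lemma continuous_on_dual_apply_fst:
  "continuous_on UNIV (\<lambda>p :: 'a dual \<times> real. dual_apply (fst p) (x :: 'a::locally_convex_t2_space))"
  by (rule continuous_on_compose2[OF continuous_on_dual_apply]) (auto intro: continuous_intros)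

lemma closed_singleton_dual: "closed {\<xi> :: 'a::locally_convex_t2_space dual}"
proof -
  have "{\<xi>} = (\<Inter>x. {\<eta>. dual_apply \<eta> x = dual_apply \<xi> x})"
    by (auto simp: dual_apply_inject[symmetric] fun_eq_iff)
  then show ?thesis
    by (auto intro!: closed_INT closed_Collect_eq continuous_on_dual_apply continuous_intros)
qed

text \<open>
  Each set on the right is a weak*-closed half-space, which makes the epigraph closed and convex.
\<close>

lemma epi_conjugate_eq_Inter:
  "epi (conjugate h) = (\<Inter>q\<in>epi h. {p. dual_apply (fst p) (fst q) - snd p \<le> snd q})"
proof (intro set_eqI)
  fix p :: "'a dual \<times> real"
  obtain \<xi> r where p: "p = (\<xi>, r)" by (cases p)
  have "a - t \<le> r \<longleftrightarrow> a - r \<le> t" for a t :: real by auto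
  then show "p \<in> epi (conjugate h) \<longleftrightarrow> p \<in> (\<Inter>q\<in>epi h. {p. dual_apply (fst p) (fst q) - snd p \<le> snd q})"
    unfolding p mem_epi_conjugate_iff by fastforce
qed

lemma closed_epi_conjugate: "closed (epi (conjugate h))"
  unfolding epi_conjugate_eq_Inter
  by (intro closed_INT ballI closed_Collect_le continuous_on_diff continuous_on_dual_apply_fst
      continuous_on_snd continuous_on_const continuous_on_id)

lemma convex_epi_conjugate: "convex (epi (conjugate h))"
  unfolding epi_conjugate_eq_Inter
proof (rule convex_INT)
  fix q
  show "convex {p. dual_apply (fst p) (fst q) - snd p \<le> snd q}"
  proof (rule convexI)
    fix p p' u v
    assume *: "p \<in> {p. dual_apply (fst p) (fst q) - snd p \<le> snd q}"
      "p' \<in> {p. dual_apply (fst p) (fst q) - snd p \<le> snd q}" "0 \<le> u" "0 \<le> v" "u + v = (1::real)"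
    have "u * (dual_apply (fst p) (fst q) - snd p) + v * (dual_apply (fst p') (fst q) - snd p') \<le> snd q"
      using * by (intro convex_bound_le) auto
    then show "u *\<^sub>R p + v *\<^sub>R p' \<in> {p. dual_apply (fst p) (fst q) - snd p \<le> snd q}"
      by (simp add: dual_apply_add dual_apply_scaleR algebra_simps)
  qed
qed

lemma weak_star_basic_neighbourhood:
  fixes \<xi> :: "'a::locally_convex_t2_space dual"
  assumes S: "open S" "(\<xi>, r) \<in> S"
  obtains F e where "finite F" "e > 0"
    "\<forall>\<eta> s. (\<forall>x\<in>F. \<bar>dual_apply \<eta> x\<bar> < e) \<longrightarrow> \<bar>s\<bar> < e \<longrightarrow> (\<xi> + \<eta>, r + s) \<in> S"
proof -
  obtain A B where AB: "open A" "open B" "(\<xi>, r) \<in> A \<times> B" "A \<times> B \<subseteq> S"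
    using open_prod_elim[OF S] by metis
  obtain O' where O': "open O'" "A = dual_apply -` O'"
    using AB(1) unfolding open_dual_def openin_pullback_topology by (auto simp flip: open_openin)
  obtain X where X: "dual_apply \<xi> \<in> Pi\<^sub>E UNIV X" "\<forall>i. open (X i)" "finite {i. X i \<noteq> UNIV}"
    "Pi\<^sub>E UNIV X \<subseteq> O'"
  proof -
    have "openin (product_topology (\<lambda>_. euclidean) UNIV) O'" using O'(1) by (simp add: open_fun_def)
    moreover have "dual_apply \<xi> \<in> O'" using O'(2) AB(3) by simp
    ultimately have "\<exists>X. dual_apply \<xi> \<in> Pi\<^sub>E UNIV X \<and> (\<forall>i. openin euclidean (X i))
        \<and> finite {i. X i \<noteq> topspace euclidean} \<and> Pi\<^sub>E UNIV X \<subseteq> O'"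
      by (rule product_topology_open_contains_basis)
    then show thesis using that unfolding topspace_euclidean open_openin[symmetric] by blast
  qed
  define F where "F = {i. X i \<noteq> UNIV}"
  have "\<exists>e>0. ball (dual_apply \<xi> x) e \<subseteq> X x" for x
    using X(1,2) open_contains_ball by blast
  then obtain e1 where e1: "\<And>x. e1 x > 0" "\<And>x. ball (dual_apply \<xi> x) (e1 x) \<subseteq> X x" by metis
  obtain e2 where e2: "e2 > 0" "ball r e2 \<subseteq> B" using AB open_contains_ball by blast
  define e where "e = Min (insert e2 (e1 ` F))"
  have fin: "finite F" using X(3) by (simp add: F_def)
  have e: "e > 0" "e \<le> e2" "\<And>x. x \<in> F \<Longrightarrow> e \<le> e1 x"
    using fin e1 e2 by (auto simp: e_def)
  show ?thesis
  proof (rule that[OF fin e(1)], intro allI impI)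
    fix \<eta> s assume \<eta>: "\<forall>x\<in>F. \<bar>dual_apply \<eta> x\<bar> < e" and s: "\<bar>s\<bar> < e"
    have "dual_apply (\<xi> + \<eta>) x \<in> X x" for x
    proof (cases "x \<in> F")
      case True
      then have "\<bar>dual_apply \<eta> x\<bar> < e1 x" using \<eta> e(3) by (meson less_le_trans)
      then have "dual_apply (\<xi> + \<eta>) x \<in> ball (dual_apply \<xi> x) (e1 x)"
        by (simp add: dual_apply_add dist_real_def)
      then show ?thesis using e1(2) by blast
    qed (simp add: F_def)
    then have "dual_apply (\<xi> + \<eta>) \<in> O'" using X(4) by auto
    then have "\<xi> + \<eta> \<in> A" by (simp add: O'(2))
    moreover have "r + s \<in> ball r e2" using s e(2) by (simp add: dist_real_def)
    ultimately show "(\<xi> + \<eta>, r + s) \<in> S" using e2(2) AB(4) by blast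
  qed
qed

text \<open>
  Induction on \<open>F\<close>: if the kernels of the functionals in \<open>F\<close> do not already suffice, choose \<open>e\<close> in
  all of them with \<open>g j e = 1\<close> and apply the hypothesis to \<open>\<psi> - \<psi> e * g j\<close>.
\<close>

lemma linear_functional_combination:
  fixes \<psi> :: "'v::real_vector \<Rightarrow> real"
  assumes "finite F" "linear \<psi>" "\<And>i. i \<in> F \<Longrightarrow> linear (g i)"
    and "\<And>v. (\<forall>i\<in>F. g i v = 0) \<Longrightarrow> \<psi> v = 0"
  shows "\<exists>c. \<forall>v. \<psi> v = (\<Sum>i\<in>F. c i * g i v)"
  using assms
proof (induction F arbitrary: \<psi> rule: finite_induct)
  case empty
  then show ?case by auto
next
  case (insert j F)
  note lin = insert.prems(1) insert.prems(2)
  show ?case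
  proof (cases "\<forall>v. (\<forall>i\<in>F. g i v = 0) \<longrightarrow> g j v = 0")
    case True
    then have "\<psi> v = 0" if "\<forall>i\<in>F. g i v = 0" for v using insert.prems(3) that by auto
    then obtain c where c: "\<forall>v. \<psi> v = (\<Sum>i\<in>F. c i * g i v)"
      using insert.IH[OF lin(1)] lin(2) by auto
    show ?thesis
    proof (intro exI[of _ "\<lambda>i. if i = j then 0 else c i"] allI)
      fix v
      have "(\<Sum>i\<in>F. c i * g i v) = (\<Sum>i\<in>F. (if i = j then 0 else c i) * g i v)"
        using insert.hyps by (intro sum.cong) auto
      then show "\<psi> v = (\<Sum>i\<in>insert j F. (if i = j then 0 else c i) * g i v)"
        using insert.hyps c by simp
    qed
  next
    case False
    then obtain e0 where e0: "\<forall>i\<in>F. g i e0 = 0" "g j e0 \<noteq> 0" by auto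
    \<comment> \<open>Normalised so that subtracting \<open>g j v *\<^sub>R e\<close> moves \<open>v\<close> into the kernel of \<open>g j\<close>.\<close>
    define e where "e = (1 / g j e0) *\<^sub>R e0"
    have e: "g i e = 0" if "i \<in> F" for i
      using e0 that lin(2)[of i] by (simp add: e_def linear_scale)
    have ej: "g j e = 1" using e0 lin(2)[of j] by (simp add: e_def linear_scale)
    define \<psi>' where "\<psi>' v = \<psi> v - \<psi> e * g j v" for v
    have "linear \<psi>'"
      using lin(1) lin(2)[of j] by (auto simp: \<psi>'_def linear_iff algebra_simps)
    moreover have "\<psi>' v = 0" if v: "\<forall>i\<in>F. g i v = 0" for v
    proof -
      have "\<psi> (v - g j v *\<^sub>R e) = 0"
        using v e ej lin(2) by (intro insert.prems(3)) (auto simp: linear_diff linear_scale)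
      then show ?thesis using lin(1) by (simp add: \<psi>'_def linear_diff linear_scale)
    qed
    ultimately obtain c where c: "\<forall>v. \<psi>' v = (\<Sum>i\<in>F. c i * g i v)"
      using insert.IH[of \<psi>'] lin(2) by auto
    show ?thesis
    proof (intro exI[of _ "\<lambda>i. if i = j then \<psi> e else c i"] allI)
      fix v
      have "(\<Sum>i\<in>F. c i * g i v) = (\<Sum>i\<in>F. (if i = j then \<psi> e else c i) * g i v)"
        using insert.hyps by (intro sum.cong) auto
      then show "\<psi> v = (\<Sum>i\<in>insert j F. (if i = j then \<psi> e else c i) * g i v)"
        using insert.hyps c[rule_format, of v] by (simp add: \<psi>'_def)
    qed
  qed
qed

lemma dual_apply_sum_right:
  "dual_apply \<eta> (\<Sum>x\<in>F. c x *\<^sub>R x) = (\<Sum>x\<in>F. c x * dual_apply \<eta> x)"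
  by (simp add: linear_sum[OF dual_apply_linear] dual_apply_scaleR_right)

text \<open>
  A basic weak*-neighbourhood constrains only finitely many evaluations.  A functional bounded below
  on it vanishes wherever these evaluations vanish, hence is a combination of them and so is itself
  the evaluation at a point \<open>x\<close>.  This identifies the separating functional on
  the dual times the reals with an element of the primal space times the reals.
\<close>

theorem weak_star_separation:
  fixes K :: "('a::locally_convex_t2_space dual \<times> real) set"
  assumes K: "convex K" "K \<noteq> {}" and notin: "(\<xi>0, r0) \<notin> closure K"
  shows "\<exists>x s d. d > 0 \<and> (\<forall>\<xi> r. (\<xi>, r) \<in> K \<longrightarrow>
    dual_apply \<xi> x + s * r \<le> dual_apply \<xi>0 x + s * r0 - d)"
proof -
  have "open (- closure K)" "(\<xi>0, r0) \<in> - closure K" using notin by auto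
  then obtain F e where F: "finite F" "e > 0"
    "\<forall>\<eta> s. (\<forall>x\<in>F. \<bar>dual_apply \<eta> x\<bar> < e) \<longrightarrow> \<bar>s\<bar> < e \<longrightarrow> (\<xi>0 + \<eta>, r0 + s) \<in> - closure K"
    using weak_star_basic_neighbourhood by metis
  define U where "U = {p :: 'a dual \<times> real. (\<forall>x\<in>F. \<bar>dual_apply (fst p) x\<bar> < e) \<and> \<bar>snd p\<bar> < e}"
  have abs_convex: "\<bar>u * a + v * b\<bar> < e"
    if "\<bar>a\<bar> < e" "\<bar>b\<bar> < e" "0 \<le> u" "0 \<le> v" "u + v = 1" for a b u v :: real
  proof -
    have "\<bar>u * a + v * b\<bar> \<le> \<bar>u * a\<bar> + \<bar>v * b\<bar>" by (rule abs_triangle_ineq)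
    also have "\<dots> = u * \<bar>a\<bar> + v * \<bar>b\<bar>" using that by (simp add: abs_mult)
    also have "\<dots> < e" using that by (intro convex_bound_lt)
    finally show ?thesis .
  qed
  have cU: "convex U"
    by (rule convexI) (auto simp: U_def dual_apply_add dual_apply_scaleR intro!: abs_convex)
  have aU: "absorbing U"
    unfolding absorbing_def
  proof
    fix p :: "'a dual \<times> real"
    define N where "N = 1 + \<bar>snd p\<bar> + (\<Sum>x\<in>F. \<bar>dual_apply (fst p) x\<bar>)"
    have sum0: "0 \<le> (\<Sum>x\<in>F. \<bar>dual_apply (fst p) x\<bar>)" by (intro sum_nonneg) auto
    have N: "N > 0" "\<bar>snd p\<bar> < N" using sum0 unfolding N_def by linarith+
    have "\<bar>dual_apply (fst p) x\<bar> < N" if "x \<in> F" for x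
      using member_le_sum[OF that, of "\<lambda>x. \<bar>dual_apply (fst p) x\<bar>"] F(1) by (simp add: N_def)
    then have "(e / N) *\<^sub>R p \<in> U"
      using N F(2) by (auto simp: U_def dual_apply_scaleR abs_mult field_simps)
    then show "\<exists>c>0. c *\<^sub>R p \<in> U" using N F(2) by (intro exI[of _ "e / N"]) auto
  qed
  have disj: "\<forall>u\<in>U. (\<xi>0, r0) + u \<notin> K"
    using F(3) closure_subset[of K] by (fastforce simp: U_def)
  obtain \<phi> :: "'a dual \<times> real \<Rightarrow> real" and d M where \<phi>: "linear \<phi>" "d > 0" "\<forall>k\<in>K. \<phi> k \<le> \<phi> (\<xi>0, r0) - d"
    "\<forall>u\<in>U. - M \<le> \<phi> u"
    using separation_from_convex[OF K cU aU disj] by blast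
  define \<psi> where "\<psi> \<eta> = \<phi> (\<eta>, 0)" for \<eta>
  have lin: "linear \<psi>" unfolding \<psi>_def by (rule linear_fst_snd(2)[OF \<phi>(1)])
  have "\<psi> \<eta> = 0" if \<eta>: "\<forall>x\<in>F. dual_apply \<eta> x = 0" for \<eta>
  proof (rule ccontr)
    assume "\<psi> \<eta> \<noteq> 0"
    define k where "k = - (\<bar>M\<bar> + 1) / \<psi> \<eta>"
    have "(k *\<^sub>R \<eta>, 0) \<in> U" using \<eta> F(2) by (simp add: U_def dual_apply_scaleR)
    then have "- M \<le> \<psi> (k *\<^sub>R \<eta>)" using \<phi>(4) by (simp add: \<psi>_def)
    then show False using \<open>\<psi> \<eta> \<noteq> 0\<close> by (simp add: linear_scale[OF lin] k_def)
  qed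
  moreover have "linear (\<lambda>\<eta>. dual_apply \<eta> x)" for x :: 'a
    by (simp add: linear_iff dual_apply_add dual_apply_scaleR)
  ultimately have "\<exists>c. \<forall>\<eta>. \<psi> \<eta> = (\<Sum>x\<in>F. c x * dual_apply \<eta> x)"
    by (intro linear_functional_combination F(1) lin) auto
  then obtain c where c: "\<And>\<eta>. \<psi> \<eta> = (\<Sum>x\<in>F. c x * dual_apply \<eta> x)" by auto
  have "\<phi> (\<xi>, r) = dual_apply \<xi> (\<Sum>x\<in>F. c x *\<^sub>R x) + \<phi> (0, 1) * r" for \<xi> r
    using linear_fst_snd(1)[OF \<phi>(1), of \<xi> r] c[of \<xi>] by (simp add: \<psi>_def dual_apply_sum_right)
  then show ?thesis using \<phi>(2,3) by metis
qed

section \<open>Lagrangians\<close>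

text \<open>
  Real thresholds for the two summands are what the lower semicontinuity of a sum requires, also
  where one of the summands is infinite.
\<close>

lemma ereal_less_add_split:
  fixes a b c :: ereal
  assumes "c < a + b" "a \<noteq> -\<infinity>" "b \<noteq> -\<infinity>"
  obtains u v :: real where "ereal u < a" "ereal v < b" "c \<le> ereal (u + v)"
proof -
  have c: "c \<noteq> \<infinity>" using assms(1) by auto
  obtain w :: real where w: "c \<le> ereal w" "ereal w < a + b"
    using ereal_dense2[OF assms(1)] by (meson less_imp_le)
  show thesis
  proof (cases a; cases b)
    fix a' b' assume ab: "a = ereal a'" "b = ereal b'"
    define h where "h = (a' + b' - w) / 2"
    have "h > 0" using w ab by (simp add: h_def)
    have "a' - h + (b' - h) = w" unfolding h_def by (simp add: field_simps)
    then show thesis using that[of "a' - h" "b' - h"] ab w(1) \<open>h > 0\<close> by simp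
  next
    fix a' assume "a = ereal a'" "b = \<infinity>"
    then show thesis using that[of "a' - 1" "w - a' + 1"] w(1) by simp
  next
    fix b' assume "a = \<infinity>" "b = ereal b'"
    then show thesis using that[of "w - b' + 1" "b' - 1"] w(1) by simp
  next
    assume "a = \<infinity>" "b = \<infinity>"
    then show thesis using that[of w 0] w(1) by simp
  qed (use assms in auto)
qed

lemma lsc_add:
  assumes f: "lsc f" "\<And>x. f x \<noteq> -\<infinity>" and g: "lsc g" "\<And>x. g x \<noteq> -\<infinity>"
  shows "lsc (\<lambda>x. f x + g x)"
  unfolding lsc_iff_open_superlevel
proof (intro allI, subst open_subopen, clarify)
  fix c x assume "c < f x + g x"
  then obtain u v :: real where uv: "ereal u < f x" "ereal v < g x" "c \<le> ereal (u + v)"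
    using ereal_less_add_split f(2) g(2) by metis
  have "c < f y + g y" if "ereal u < f y" "ereal v < g y" for y
    using that uv(3) by (cases "f y"; cases "g y") (auto intro: le_less_trans)
  moreover have "open ({y. ereal u < f y} \<inter> {y. ereal v < g y})"
    using f(1) g(1) by (auto simp: lsc_iff_open_superlevel)
  ultimately show "\<exists>S. open S \<and> x \<in> S \<and> S \<subseteq> {y. c < f y + g y}"
    using uv by (intro exI[of _ "{y. ereal u < f y} \<inter> {y. ereal v < g y}"]) auto
qed

lemma lsc_mult_nonneg:
  assumes "lsc f" "c \<ge> 0"
  shows "lsc (\<lambda>x. ereal c * f x)"
proof (cases "c = 0")
  case True
  have "{x. a < ereal 0 * f x} = (if a < 0 then UNIV else {})" for a
    by (auto simp flip: zero_ereal_def)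
  then show ?thesis using True by (simp add: lsc_iff_open_superlevel)
next
  case False
  then have "a < ereal c * y \<longleftrightarrow> a / ereal c < y" for a y
    using assms(2) by (subst ereal_divide_less_iff) (auto simp: mult.commute)
  then show ?thesis using assms(1) by (simp add: lsc_iff_open_superlevel)
qed

lemma convex_fun_add:
  assumes "convex_fun f" "convex_fun g"
  shows "convex_fun (\<lambda>x. f x + g x)"
  unfolding convex_fun_def
proof (intro allI impI)
  fix x y and u v :: real assume uv: "u \<ge> 0" "v \<ge> 0" "u + v = 1"
  have "f (u *\<^sub>R x + v *\<^sub>R y) + g (u *\<^sub>R x + v *\<^sub>R y)
      \<le> (ereal u * f x + ereal v * f y) + (ereal u * g x + ereal v * g y)"
    using assms uv by (intro add_mono) (auto simp: convex_fun_def)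
  then show "f (u *\<^sub>R x + v *\<^sub>R y) + g (u *\<^sub>R x + v *\<^sub>R y)
      \<le> ereal u * (f x + g x) + ereal v * (f y + g y)"
    using uv by (simp add: ereal_pos_distrib add_ac)
qed

lemma convex_fun_mult_nonneg:
  assumes "convex_fun f" "c \<ge> 0"
  shows "convex_fun (\<lambda>x. ereal c * f x)"
  unfolding convex_fun_def
proof (intro allI impI)
  fix x y and u v :: real assume uv: "u \<ge> 0" "v \<ge> 0" "u + v = 1"
  have "ereal c * f (u *\<^sub>R x + v *\<^sub>R y) \<le> ereal c * (ereal u * f x + ereal v * f y)"
    using assms uv by (intro ereal_mult_left_mono) (auto simp: convex_fun_def)
  then show "ereal c * f (u *\<^sub>R x + v *\<^sub>R y) \<le> ereal u * (ereal c * f x) + ereal v * (ereal c * f y)"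
    using assms(2) by (simp add: ereal_pos_distrib mult_ac)
qed

text \<open>
  The common point \<open>x0\<close> of the domains makes the Lagrangian proper: a sum of proper
  functions with disjoint domains is identically infinite.
\<close>

lemma lagrangian_lsc_proper_convex:
  fixes f :: "'a::locally_convex_t2_space \<Rightarrow> ereal"
  assumes f: "f \<in> lsc_proper_convex" and ft: "\<And>t. t \<in> H \<Longrightarrow> ft t \<in> lsc_proper_convex"
    and "finite H" and \<mu>: "\<And>t. t \<in> H \<Longrightarrow> \<mu> t \<ge> 0"
    and x0: "f x0 < \<infinity>" "\<And>t. t \<in> H \<Longrightarrow> ft t x0 < \<infinity>"
  shows "lagrangian f ft H \<mu> \<in> lsc_proper_convex"
proof -
  let ?S = "\<lambda>x. \<Sum>t\<in>H. ereal (\<mu> t) * ft t x"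
  have "lsc ?S \<and> convex_fun ?S \<and> (\<forall>x. ?S x \<noteq> -\<infinity>) \<and> ?S x0 < \<infinity>"
    using \<open>finite H\<close> ft \<mu> x0(2)
  proof (induction H rule: finite_induct)
    case empty
    show ?case by (simp add: lsc_iff_open_superlevel convex_fun_def)
  next
    case (insert t H)
    have t: "lsc (ft t)" "convex_fun (ft t)" "\<And>x. ft t x \<noteq> -\<infinity>" "\<mu> t \<ge> 0" "ft t x0 < \<infinity>"
      using insert.prems by (auto simp: lsc_proper_convex_def proper_def)
    have nt: "ereal (\<mu> t) * ft t x \<noteq> -\<infinity>" for x
      using t(3)[of x] t(4) by (cases "ft t x") auto
    have x0t: "ereal (\<mu> t) * ft t x0 < \<infinity>"
      using t(3)[of x0] t(5) by (cases "ft t x0") auto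
    have IH: "lsc (\<lambda>x. \<Sum>t\<in>H. ereal (\<mu> t) * ft t x)" "convex_fun (\<lambda>x. \<Sum>t\<in>H. ereal (\<mu> t) * ft t x)"
      "\<And>x. (\<Sum>t\<in>H. ereal (\<mu> t) * ft t x) \<noteq> -\<infinity>" "(\<Sum>t\<in>H. ereal (\<mu> t) * ft t x0) < \<infinity>"
      using insert.IH insert.prems by auto
    have "(ereal (\<mu> t) * ft t x0) + (\<Sum>t\<in>H. ereal (\<mu> t) * ft t x0) < \<infinity>"
      using x0t IH(4) by simp
    moreover have "(ereal (\<mu> t) * ft t x) + (\<Sum>t\<in>H. ereal (\<mu> t) * ft t x) \<noteq> -\<infinity>" for x
      using nt IH(3) by simp
    ultimately show ?case
      using lsc_add[OF lsc_mult_nonneg[OF t(1,4)] nt IH(1,3)]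
        convex_fun_add[OF convex_fun_mult_nonneg[OF t(2,4)] IH(2)] insert.hyps
      by simp
  qed
  moreover have "lsc f" "convex_fun f" "\<And>x. f x \<noteq> -\<infinity>"
    using f by (auto simp: lsc_proper_convex_def proper_def)
  ultimately have "lsc (\<lambda>x. f x + ?S x)" "convex_fun (\<lambda>x. f x + ?S x)" "\<And>x. f x + ?S x \<noteq> -\<infinity>"
    "f x0 + ?S x0 < \<infinity>"
    using x0(1) by (auto intro: lsc_add convex_fun_add)
  moreover have "lagrangian f ft H \<mu> = (\<lambda>x. f x + ?S x)" by (auto simp: lagrangian_def)
  ultimately show ?thesis by (auto simp: lsc_proper_convex_def proper_def domain_def)
qed

section \<open>The closed convex hull of the multiplier epigraphs\<close>

lemma mem_epi_constrained_iff:
  "(x, t) \<in> epi (\<lambda>x. f x + indicator_fun S x) \<longleftrightarrow> x \<in> S \<and> f x \<le> ereal t"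
  by (simp add: epi_def indicator_fun_def)

text \<open>
  Weak duality: on the feasible set every Lagrangian lies below \<open>f\<close>, and conjugation reverses
  the order.
\<close>

lemma multiplier_epis_subset:
  assumes "\<H> \<subseteq> nonempty_finite_subsets T"
  shows "multiplier_epis f ft \<H> \<subseteq> epi (conjugate (\<lambda>x. f x + indicator_fun (feasible T ft) x))"
proof clarify
  fix \<xi> r assume "(\<xi>, r) \<in> multiplier_epis f ft \<H>"
  then obtain H \<mu> where H: "H \<in> \<H>" "\<mu> \<in> H \<rightarrow>\<^sub>E {0..}"
    and r: "(\<xi>, r) \<in> epi (conjugate (lagrangian f ft H \<mu>))" by (auto simp: multiplier_epis_def)
  show "(\<xi>, r) \<in> epi (conjugate (\<lambda>x. f x + indicator_fun (feasible T ft) x))"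
    unfolding mem_epi_conjugate_iff mem_epi_constrained_iff
  proof clarify
    fix x s assume x: "x \<in> feasible T ft" "f x \<le> ereal s"
    have "(\<Sum>t\<in>H. ereal (\<mu> t) * ft t x) \<le> 0"
    proof (rule sum_nonpos)
      fix t assume "t \<in> H"
      then have "ft t x \<le> 0" "0 \<le> \<mu> t"
        using x(1) H assms by (auto simp: feasible_def nonempty_finite_subsets_def)
      then show "ereal (\<mu> t) * ft t x \<le> 0" by (simp add: ereal_mult_le_0_iff)
    qed
    then have "lagrangian f ft H \<mu> x \<le> ereal s"
      using add_mono[OF x(2)] unfolding lagrangian_def by fastforce
    then show "dual_apply \<xi> x - s \<le> r" using r by (simp add: mem_epi_conjugate_iff) (simp add: epi_def)
  qed
qed

lemma nonpos_if_multiples_bounded: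
  fixes a b :: ereal
  assumes "a \<noteq> -\<infinity>" and bound: "\<And>c::real. c \<ge> 0 \<Longrightarrow> a + ereal c * b \<le> ereal m"
  shows "b \<le> 0"
proof (rule ccontr)
  assume "\<not> b \<le> 0"
  then have "b > 0" by simp
  have "a \<noteq> \<infinity>" using bound[of 0] by auto
  then obtain a' where a: "a = ereal a'" using assms(1) by (cases a) auto
  show False
  proof (cases b)
    case (real b')
    then have "b' > 0" using \<open>b > 0\<close> by simp
    then show False using bound[of "(\<bar>m - a'\<bar> + 1) / b'"] a real by simp
  next
    case PInf
    then show False using bound[of 1] a by simp
  qed (use \<open>b > 0\<close> in simp)
qed

text \<open>
  Biconjugation turns the bound into \<open>lagrangian f ft H \<mu> y \<le> a\<close> for all \<open>H\<close> and \<open>\<mu>\<close>.  The zero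
  multiplier then bounds \<open>f y\<close>, and a multiplier concentrated at one \<open>t\<close> and growing without bound
  forces \<open>ft t y \<le> 0\<close>; since the family is covering, every constraint is reached.
\<close>

lemma feasible_if_multiplier_epis_bounded:
  fixes f :: "'a::locally_convex_t2_space \<Rightarrow> ereal"
  assumes \<H>: "\<H> \<noteq> {}" "\<H> \<subseteq> nonempty_finite_subsets T" "covering T \<H>"
    and \<Gamma>: "insert f (ft ` T) \<subseteq> lsc_proper_convex" and x0: "x0 \<in> feasible T ft \<inter> domain f"
    and bound: "\<And>\<xi> r. (\<xi>, r) \<in> multiplier_epis f ft \<H> \<Longrightarrow> dual_apply \<xi> y - r \<le> a"
  shows "y \<in> feasible T ft" "f y \<le> ereal a"
proof -
  have L: "lagrangian f ft H \<mu> y \<le> ereal a" if H: "H \<in> \<H>" "\<mu> \<in> H \<rightarrow>\<^sub>E {0..}" for H \<mu>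
  proof (rule Fenchel_Moreau)
    have "H \<subseteq> T" "finite H" using H(1) \<H>(2) by (auto simp: nonempty_finite_subsets_def)
    moreover have "ft t x0 < \<infinity>" if "t \<in> T" for t
      using x0 that by (auto simp: feasible_def intro: le_less_trans[of _ 0])
    ultimately show "lagrangian f ft H \<mu> \<in> lsc_proper_convex"
      using \<Gamma> H(2) x0
      by (intro lagrangian_lsc_proper_convex[where ?x0.0 = x0]) (auto simp: domain_def subset_iff)
    show "dual_apply \<xi> y - r \<le> a" if "(\<xi>, r) \<in> epi (conjugate (lagrangian f ft H \<mu>))" for \<xi> r
      using that H by (intro bound) (auto simp: multiplier_epis_def)
  qed
  have single: "f y + ereal c * ft t y \<le> ereal a" if "H \<in> \<H>" "t \<in> H" "c \<ge> 0" for H t c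
  proof -
    let ?\<mu> = "\<lambda>s\<in>H. if s = t then c else 0"
    have "(\<Sum>s\<in>H. ereal (?\<mu> s) * ft s y) = (\<Sum>s\<in>H. if s = t then ereal c * ft t y else 0)"
      by (intro sum.cong) (simp_all flip: zero_ereal_def)
    also have "\<dots> = ereal c * ft t y"
      using that \<H>(2) by (subst sum.delta) (auto simp: nonempty_finite_subsets_def)
    finally have "lagrangian f ft H ?\<mu> y = f y + ereal c * ft t y" by (simp only: lagrangian_def)
    then show ?thesis using L[OF that(1), of ?\<mu>] that(3) by auto
  qed
  obtain H t where "H \<in> \<H>" "t \<in> H" using \<H>(1,2) by (fastforce simp: nonempty_finite_subsets_def)
  from single[OF this, of 0] show "f y \<le> ereal a" by (simp flip: zero_ereal_def)
  have "f y \<noteq> -\<infinity>" using \<Gamma> by (auto simp: lsc_proper_convex_def proper_def)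
  show "y \<in> feasible T ft"
    unfolding feasible_def
  proof clarify
    fix t assume "t \<in> T"
    then obtain H where "H \<in> \<H>" "t \<in> H" using \<H>(3) by (auto simp: covering_def)
    then show "ft t y \<le> 0" using single \<open>f y \<noteq> -\<infinity>\<close> by (intro nonpos_if_multiples_bounded) auto
  qed
qed

text \<open>
  A point of the right-hand side outside the left-hand side could be separated from the
  multiplier epigraphs by some \<open>(x, s)\<close>, where \<open>s \<le> 0\<close> because they are closed upwards.  If \<open>s < 0\<close>, the
  preceding lemma, applied to a positive multiple of \<open>x\<close>, contradicts the separation.
  If \<open>s = 0\<close>, the same contradiction arises from the points \<open>x0 + l *\<^sub>R x\<close> with \<open>x0\<close> feasible and in
  the domain of \<open>f\<close>, when \<open>l\<close> is large.
\<close>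

theorem closure_convex_hull_multiplier_epis:
  fixes f :: "'a::locally_convex_t2_space \<Rightarrow> ereal"
  assumes \<H>: "\<H> \<noteq> {}" "\<H> \<subseteq> nonempty_finite_subsets T" "covering T \<H>"
    and \<Gamma>: "insert f (ft ` T) \<subseteq> lsc_proper_convex" and ne: "feasible T ft \<inter> domain f \<noteq> {}"
  shows "closure (convex hull multiplier_epis f ft \<H>)
    = epi (conjugate (\<lambda>x. f x + indicator_fun (feasible T ft) x))" (is "closure (convex hull ?A) = ?E")
proof (rule antisym)
  have AE: "?A \<subseteq> ?E" by (rule multiplier_epis_subset[OF \<H>(2)])
  show "closure (convex hull ?A) \<subseteq> ?E"
    by (intro closure_minimal hull_minimal AE convex_epi_conjugate closed_epi_conjugate)
  obtain x0 where x0: "x0 \<in> feasible T ft \<inter> domain f" using ne by auto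
  have "f x0 < \<infinity>" "f x0 \<noteq> -\<infinity>"
    using x0 \<Gamma> by (auto simp: domain_def lsc_proper_convex_def proper_def)
  then obtain f0 where f0: "f x0 = ereal f0" by (cases "f x0") auto
  \<comment> \<open>Affine bounds valid on the multiplier epigraphs carry over to the whole right-hand side.\<close>
  have bound: "dual_apply \<xi> y - r \<le> a"
    if "(\<xi>, r) \<in> ?E" "\<And>\<xi> r. (\<xi>, r) \<in> ?A \<Longrightarrow> dual_apply \<xi> y - r \<le> a" for \<xi> r y a
  proof -
    have "(y, a) \<in> epi (\<lambda>x. f x + indicator_fun (feasible T ft) x)"
      unfolding mem_epi_constrained_iff
      using feasible_if_multiplier_epis_bounded[OF \<H> \<Gamma> x0 that(2)] by blast
    then have "dual_apply \<xi> y - a \<le> r" using that(1) unfolding mem_epi_conjugate_iff by blast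
    then show ?thesis by simp
  qed
  have bound0: "dual_apply \<xi> x0 - r \<le> f0" if "(\<xi>, r) \<in> ?A" for \<xi> r
  proof -
    have "(x0, f0) \<in> epi (\<lambda>x. f x + indicator_fun (feasible T ft) x)"
      using x0 f0 by (simp add: mem_epi_constrained_iff)
    moreover have "(\<xi>, r) \<in> ?E" using that AE by blast
    ultimately have "dual_apply \<xi> x0 - f0 \<le> r" unfolding mem_epi_conjugate_iff by blast
    then show ?thesis by simp
  qed
  \<comment> \<open>An upward ray in the multiplier epigraphs, from an affine minorant of \<open>f\<close> and the zero multiplier.\<close>
  obtain \<xi>1 r1 where A1: "\<And>r. r \<ge> 0 \<Longrightarrow> (\<xi>1, r1 + r) \<in> ?A"
  proof -
    obtain H where H: "H \<in> \<H>" using \<H>(1) by auto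
    let ?\<mu> = "\<lambda>t\<in>H. 0 :: real"
    have "lagrangian f ft H ?\<mu> x = f x" for x
      by (simp add: lagrangian_def flip: zero_ereal_def)
    then have L: "lagrangian f ft H ?\<mu> = f" by (intro ext)
    have "?\<mu> \<in> H \<rightarrow>\<^sub>E {0..}" by auto
    then have "epi (conjugate (lagrangian f ft H ?\<mu>)) \<subseteq> ?A"
      using H unfolding multiplier_epis_def by blast
    then have sub: "epi (conjugate f) \<subseteq> ?A" by (simp only: L)
    obtain \<xi> r where \<xi>r: "(\<xi>, r) \<in> epi (conjugate f)" using epi_conjugate_nonempty[of f] \<Gamma> by auto
    have "(\<xi>, r + s) \<in> ?A" if "s \<ge> 0" for s
    proof -
      have "conjugate f \<xi> \<le> ereal r" using \<xi>r by (simp add: epi_def)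
      also have "\<dots> \<le> ereal (r + s)" using that by simp
      finally show ?thesis using sub by (auto simp: epi_def)
    qed
    then show thesis by (rule that)
  qed
  show "?E \<subseteq> closure (convex hull ?A)"
  proof (clarify, rule ccontr)
    fix \<xi>0 r0 assume E: "(\<xi>0, r0) \<in> ?E" and notin: "(\<xi>0, r0) \<notin> closure (convex hull ?A)"
    have "convex hull ?A \<noteq> {}" using A1[of 0] by auto
    from weak_star_separation[OF convex_convex_hull this notin]
    obtain x s d where d: "d > 0"
      and sep: "\<forall>\<xi> r. (\<xi>, r) \<in> convex hull ?A \<longrightarrow>
        dual_apply \<xi> x + s * r \<le> dual_apply \<xi>0 x + s * r0 - d"
      by blast
    have sepA: "dual_apply \<xi> x + s * r \<le> dual_apply \<xi>0 x + s * r0 - d" if "(\<xi>, r) \<in> ?A" for \<xi> r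
      using that by (intro sep[rule_format] hull_inc)
    have "s \<le> 0"
    proof (rule ccontr)
      assume "\<not> s \<le> 0"
      define C where "C = dual_apply \<xi>0 x + s * r0 - d - dual_apply \<xi>1 x - s * r1"
      have "s * r \<le> C" if "r \<ge> 0" for r
        using sepA[OF A1[OF that]] by (simp add: C_def algebra_simps)
      from this[of "(\<bar>C\<bar> + 1) / s"] show False using \<open>\<not> s \<le> 0\<close> by simp
    qed
    show False
    proof (cases "s = 0")
      case False
      define k where "k = - inverse s"
      have k: "k > 0" "\<And>r. k * (s * r) = - r" using \<open>s \<le> 0\<close> False by (auto simp: k_def)
      have "dual_apply \<xi>0 (k *\<^sub>R x) - r0 \<le> dual_apply \<xi>0 (k *\<^sub>R x) - r0 - k * d"
      proof (rule bound[OF E])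
        fix \<xi> r assume "(\<xi>, r) \<in> ?A"
        then have "k * (dual_apply \<xi> x + s * r) \<le> k * (dual_apply \<xi>0 x + s * r0 - d)"
          using k(1) by (intro mult_left_mono sepA) auto
        then show "dual_apply \<xi> (k *\<^sub>R x) - r \<le> dual_apply \<xi>0 (k *\<^sub>R x) - r0 - k * d"
          by (simp add: dual_apply_scaleR_right distrib_left right_diff_distrib k(2))
      qed
      then show False using mult_pos_pos[OF k(1) d] by simp
    next
      case True
      have "l * d \<le> f0 + r0 - dual_apply \<xi>0 x0" if "l \<ge> 0" for l
      proof -
        have "dual_apply \<xi>0 (x0 + l *\<^sub>R x) - r0 \<le> f0 + l * (dual_apply \<xi>0 x - d)"
        proof (rule bound[OF E])
          fix \<xi> r assume A: "(\<xi>, r) \<in> ?A"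
          have "l * dual_apply \<xi> x \<le> l * (dual_apply \<xi>0 x - d)"
            using sepA[OF A] True that by (intro mult_left_mono) auto
          then show "dual_apply \<xi> (x0 + l *\<^sub>R x) - r \<le> f0 + l * (dual_apply \<xi>0 x - d)"
            using bound0[OF A] by (simp add: dual_apply_add_right dual_apply_scaleR_right)
        qed
        then show ?thesis
          by (simp add: dual_apply_add_right dual_apply_scaleR_right algebra_simps)
      qed
      from this[of "(\<bar>f0 + r0 - dual_apply \<xi>0 x0\<bar> + 1) / d"] show False using d by simp
    qed
  qed
qed

section \<open>The fibre over a functional, and the duality theorem\<close>

lemma closure_INF_sublevel:
  fixes g :: "'h \<Rightarrow> 'm \<Rightarrow> ereal"
  shows "closure {r::real. \<exists>H\<in>\<H>. \<exists>\<mu>\<in>M H. g H \<mu> \<le> ereal r}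
    = {r. (INF H\<in>\<H>. INF \<mu>\<in>M H. g H \<mu>) \<le> ereal r}" (is "closure ?I = {r. ?\<phi> \<le> ereal r}")
proof (rule antisym)
  have "closed {r. ?\<phi> \<le> ereal r}" by (intro closed_Collect_le continuous_intros)
  then show "closure ?I \<subseteq> {r. ?\<phi> \<le> ereal r}"
    by (intro closure_minimal) (auto intro: INF_lower2)
  show "{r. ?\<phi> \<le> ereal r} \<subseteq> closure ?I"
  proof (clarsimp simp: closure_approachable)
    fix r e :: real assume r: "?\<phi> \<le> ereal r" and e: "e > 0"
    have "?\<phi> < ereal (r + e / 2)" using r e by (auto intro: le_less_trans)
    then have "r + e / 2 \<in> ?I" by (auto simp: INF_less_iff intro: less_imp_le)
    then show "\<exists>s. (\<exists>H\<in>\<H>. \<exists>\<mu>\<in>M H. g H \<mu> \<le> ereal s) \<and> dist s r < e"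
      using e by (intro exI[of _ "r + e / 2"]) (auto simp: dist_real_def)
  qed
qed

text \<open>
  The fibre is a half-line that may lack its left end point, because the infimum that defines the
  dual value need not be attained; the closure adds exactly this end point.
\<close>

lemma closure_multiplier_epis_fibre:
  fixes \<xi> :: "'a::locally_convex_t2_space dual"
  shows "closure (multiplier_epis f ft \<H> \<inter> ({\<xi>} \<times> UNIV))
    = {\<xi>} \<times> {r. multiplier_dual_value f ft \<H> \<xi> \<le> ereal r}"
proof -
  have "multiplier_epis f ft \<H> \<inter> ({\<xi>} \<times> UNIV)
      = {\<xi>} \<times> {r. \<exists>H\<in>\<H>. \<exists>\<mu>\<in>H \<rightarrow>\<^sub>E {0..}. conjugate (lagrangian f ft H \<mu>) \<xi> \<le> ereal r}"
    by (auto simp: multiplier_epis_def epi_def)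
  then show ?thesis
    by (simp only: closure_Times closure_closed[OF closed_singleton_dual] closure_INF_sublevel
        multiplier_dual_value_def)
qed

lemma epi_fibre: "epi g \<inter> ({\<xi>} \<times> UNIV) = {\<xi>} \<times> {r. g \<xi> \<le> ereal r}"
  by (auto simp: epi_def)

theorem theorem6p1:
  fixes f :: "'a::locally_convex_t2_space \<Rightarrow> ereal"
    and ft :: "'t \<Rightarrow> 'a \<Rightarrow> ereal"
    and T :: "'t set"
    and \<H> :: "'t set set"
    and \<xi> :: "'a dual"
  assumes "infinite T"
    and "proper f" and "convex_fun f"
    and "\<And>t. t \<in> T \<Longrightarrow> proper (ft t)" and "\<And>t. t \<in> T \<Longrightarrow> convex_fun (ft t)"
    and "\<H> \<noteq> {}" and "\<H> \<subseteq> nonempty_finite_subsets T"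
  shows
    "(conjugate (\<lambda>x. f x + indicator_fun (feasible T ft) x) \<xi> = multiplier_dual_value f ft \<H> \<xi>
      \<longrightarrow> closure (convex hull multiplier_epis f ft \<H>) \<inter> ({\<xi>} \<times> UNIV)
         = closure (multiplier_epis f ft \<H> \<inter> ({\<xi>} \<times> UNIV)))
    \<and>
    (insert f (ft ` T) \<subseteq> lsc_proper_convex \<and> feasible T ft \<inter> domain f \<noteq> {} \<and> covering T \<H>
      \<longrightarrow> (conjugate (\<lambda>x. f x + indicator_fun (feasible T ft) x) \<xi> = multiplier_dual_value f ft \<H> \<xi>
        \<longleftrightarrow> closure (convex hull multiplier_epis f ft \<H>) \<inter> ({\<xi>} \<times> UNIV)
           = closure (multiplier_epis f ft \<H> \<inter> ({\<xi>} \<times> UNIV))))"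
    (is "(?i \<longrightarrow> ?ii) \<and> (?reg \<longrightarrow> (?i \<longleftrightarrow> ?ii))")
proof -
  let ?A = "multiplier_epis f ft \<H>" and ?F = "{\<xi>} \<times> (UNIV :: real set)"
  let ?h = "conjugate (\<lambda>x. f x + indicator_fun (feasible T ft) x)"
  have forward: ?ii if ?i
  proof (rule antisym)
    have "closure (convex hull ?A) \<subseteq> epi ?h"
      by (intro closure_minimal hull_minimal multiplier_epis_subset[OF assms(7)]
          convex_epi_conjugate closed_epi_conjugate)
    then show "closure (convex hull ?A) \<inter> ?F \<subseteq> closure (?A \<inter> ?F)"
      using epi_fibre[of ?h \<xi>] that by (auto simp: closure_multiplier_epis_fibre)
    have "?A \<inter> ?F \<subseteq> convex hull ?A" by (auto intro: hull_inc)
    then have "closure (?A \<inter> ?F) \<subseteq> closure (convex hull ?A)" by (rule closure_mono)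
    then show "closure (?A \<inter> ?F) \<subseteq> closure (convex hull ?A) \<inter> ?F"
      by (auto simp: closure_multiplier_epis_fibre)
  qed
  have backward: ?i if ?reg ?ii
  proof -
    have "closure (convex hull ?A) = epi ?h"
      using that(1) by (intro closure_convex_hull_multiplier_epis assms(6,7)) auto
    then have "{\<xi>} \<times> {r. ?h \<xi> \<le> ereal r} = {\<xi>} \<times> {r. multiplier_dual_value f ft \<H> \<xi> \<le> ereal r}"
      using that(2) epi_fibre[of ?h \<xi>] closure_multiplier_epis_fibre[of f ft \<H> \<xi>] by simp
    then have *: "?h \<xi> \<le> ereal r \<longleftrightarrow> multiplier_dual_value f ft \<H> \<xi> \<le> ereal r" for r by blast
    show ?i
    proof (rule antisym)
      show "?h \<xi> \<le> multiplier_dual_value f ft \<H> \<xi>" using * by (blast intro: ereal_le_real)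
      show "multiplier_dual_value f ft \<H> \<xi> \<le> ?h \<xi>" using * by (blast intro: ereal_le_real)
    qed
  qed
  show ?thesis using forward backward by blast
qed

end
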